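(* Let $(p_{ij} \colon X_j \to X_i)_{i \sqsubseteq j \in I}$ be a projective system of topological spaces, with canonical projective limit $X, (p_i)_{i \in I}$. If every $X_i$ is sober, and if $\mathcal H_{\mathsf V} X$ (with the maps $\mathcal H_{\mathsf V}\, p_i$) is a projective limit of $(\mathcal H_{\mathsf V}\, p_{ij} \colon \mathcal H_{\mathsf V} X_j \to \mathcal H_{\mathsf V} X_i)_{i \sqsubseteq j \in I}$, then $\mathcal P^{\mathrm q}_{\mathsf V} X$ (with the maps $\mathcal P^{\mathrm q}_{\mathsf V}\, p_i$) is a projective limit of $(\mathcal P^{\mathrm q}_{\mathsf V}\, p_{ij} \colon \mathcal P^{\mathrm q}_{\mathsf V} X_j \to \mathcal P^{\mathrm q}_{\mathsf V} X_i)_{i \sqsubseteq j \in I}$, and $\mathcal P^{\mathbf A}_{\mathsf V} X$ (with the maps $\mathcal P^{\mathbf A}_{\mathsf V}\, p_i$) is a projective limit of $(\mathcal P^{\mathbf A}_{\mathsf V}\, p_{ij} \colon \mathcal P^{\mathbf A}_{\mathsf V} X_j \to \mathcal P^{\mathbf A}_{\mathsf V} X_i)_{i \sqsubseteq j \in I}$.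
   Context: **Topology.** $\mathcal O X$ is the lattice of open subsets of $X$. The specialization preordering is: $x \leq y$ iff every open neighborhood of $x$ contains $y$; $\uparrow A$ denotes upward closure, $cl(A)$ topological closure, $f[A]$ direct image. A subset is saturated iff it is upwards-closed. Compactness is the open cover property, with no separation axiom. A space is sober iff it is $T_0$ and every irreducible closed subset is the closure of a point. **Projective systems.** A projective system $(p_{ij} \colon X_j \to X_i)_{i \sqsubseteq j \in I}$ consists of a directed preordered set $(I,\sqsubseteq)$, spaces $X_i$, and continuous maps $p_{ij}$ ($i \sqsubseteq j$) with $p_{ii} = \mathrm{id}$ and $p_{ij} \circ p_{jk} = p_{ik}$ for $i \sqsubseteq j \sqsubseteq k$. Its canonical projective limit is $X = \{\vec x \in \prod_{i} X_i \mid p_{ij}(x_j) = x_i \text{ for all } i \sqsubseteq j\}$ with the subspace topology of the product, $p_i$ being projection onto coordinate $i$. Saying that $Y$ with maps $(q_i)_{i\in I}$ is a projective limit of a projective system with canonical limit $Z$ means that the map $y \mapsto (q_i(y))_{i \in I}$ is a (well-defined) homeomorphism from $Y$ onto $Z$. **Functors (endofunctors on topological spaces).** - $\mathcal H_{\mathsf V} X$: the set of non-empty closed subsets of $X$, with topology generated by $\Diamond U = \{C \mid C \cap U \neq \emptyset\}$, $U \in \mathcal O X$; a continuous map $f \colon X \to Y$ acts by $C \mapsto cl(f[C])$. - $\mathcal P^{\mathrm q}_{\mathsf V} X$: the set of quasi-lenses on $X$, i.e., pairs $(Q,C)$ of a compact saturated subset $Q$ and a closed subset $C$ of $X$ such that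 (1) $Q \cap C \neq \emptyset$; (2) $Q \subseteq \uparrow(Q \cap C)$; (3) for every open neighborhood $U$ of $Q$, $C \subseteq cl(U \cap C)$. Its topology is generated by the sets $\{(Q,C) \mid Q \subseteq U\}$ and $\{(Q,C) \mid C \cap U \neq \emptyset\}$, $U \in \mathcal O X$. A continuous map $f$ acts by $(Q,C) \mapsto (\uparrow f[Q], cl(f[C]))$. - $\mathcal P^{\mathbf A}_{\mathsf V} X$: the set of $\mathbf A$-valuations on $X$, where $\mathbf A = \{0,\mathbf M,1\}$ with $0<\mathbf M<1$. An $\mathbf A$-valuation is a Scott-continuous map $\alpha \colon \mathcal O X \to \mathbf A$ with $\alpha(\emptyset)=0$, $\alpha(X)=1$ and, for all open $U,V$: if $\alpha(U)=0$ then $\alpha(U \cup V)=\alpha(V)$; if $\alpha(V)=1$ then $\alpha(U\cap V)=\alpha(U)$. Its topology is generated by the sets $\{\alpha \mid \alpha(U)=1\}$ and $\{\alpha \mid \alpha(U)\neq 0\}$, $U \in \mathcal O X$. A continuous map $f \colon X \to Y$ acts by $\alpha \mapsto (V \mapsto \alpha(f^{-1}(V)))$. *)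

theory Defs
  imports "HOL-Analysis.Analysis"
begin

section \<open>Sober spaces\<close>

definition spec_le :: "'a topology \<Rightarrow> 'a \<Rightarrow> 'a \<Rightarrow> bool" where
  "spec_le X x y \<longleftrightarrow> x \<in> topspace X \<and> y \<in> topspace X \<and> (\<forall>U. openin X U \<and> x \<in> U \<longrightarrow> y \<in> U)"

definition up_closure :: "'a topology \<Rightarrow> 'a set \<Rightarrow> 'a set" where
  "up_closure X A = {y. \<exists>x\<in>A. spec_le X x y}"

definition saturatedin :: "'a topology \<Rightarrow> 'a set \<Rightarrow> bool" where
  "saturatedin X A \<longleftrightarrow> A \<subseteq> topspace X \<and> (\<forall>x\<in>A. \<forall>y. spec_le X x y \<longrightarrow> y \<in> A)"

definition irreducible_closedin :: "'a topology \<Rightarrow> 'a set \<Rightarrow> bool" where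
  "irreducible_closedin X C \<longleftrightarrow> closedin X C \<and> C \<noteq> {} \<and>
     (\<forall>C1 C2. closedin X C1 \<and> closedin X C2 \<and> C \<subseteq> C1 \<union> C2 \<longrightarrow> C \<subseteq> C1 \<or> C \<subseteq> C2)"

definition sober_space :: "'a topology \<Rightarrow> bool" where
  "sober_space X \<longleftrightarrow> t0_space X \<and>
     (\<forall>C. irreducible_closedin X C \<longrightarrow> (\<exists>x\<in>topspace X. C = X closure_of {x}))"


section \<open>Projective systems and their limits\<close>

text \<open>As usual, directed sets are non-empty.\<close>

definition directed_set :: "'i set \<Rightarrow> ('i \<Rightarrow> 'i \<Rightarrow> bool) \<Rightarrow> bool" where
  "directed_set I le \<longleftrightarrow> I \<noteq> {} \<and> (\<forall>i\<in>I. \<forall>j\<in>I. \<exists>k\<in>I. le i k \<and> le j k)"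

text \<open>The map \<open>p i j\<close> goes from \<open>X j\<close> to \<open>X i\<close>; only its values on \<open>topspace (X j)\<close>
  matter. The spaces \<open>X i\<close> may have different carriers, inside a common type.\<close>

definition projective_system ::
  "'i set \<Rightarrow> ('i \<Rightarrow> 'i \<Rightarrow> bool) \<Rightarrow> ('i \<Rightarrow> 'a topology) \<Rightarrow> ('i \<Rightarrow> 'i \<Rightarrow> 'a \<Rightarrow> 'a) \<Rightarrow> bool" where
  "projective_system I le X p \<longleftrightarrow>
     reflp_on I le \<and> transp_on I le \<and> directed_set I le \<and>
     (\<forall>i\<in>I. \<forall>j\<in>I. le i j \<longrightarrow> continuous_map (X j) (X i) (p i j)) \<and>
     (\<forall>i\<in>I. \<forall>x\<in>topspace (X i). p i i x = x) \<and>
     (\<forall>i\<in>I. \<forall>j\<in>I. \<forall>k\<in>I. le i j \<and> le j k \<longrightarrow>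
        (\<forall>x\<in>topspace (X k). p i j (p j k x) = p i k x))"

definition canonical_limit ::
  "'i set \<Rightarrow> ('i \<Rightarrow> 'i \<Rightarrow> bool) \<Rightarrow> ('i \<Rightarrow> 'a topology) \<Rightarrow> ('i \<Rightarrow> 'i \<Rightarrow> 'a \<Rightarrow> 'a)
     \<Rightarrow> ('i \<Rightarrow> 'a) topology" where
  "canonical_limit I le X p =
     subtopology (product_topology X I)
       {x \<in> (\<Pi>\<^sub>E i\<in>I. topspace (X i)). \<forall>i\<in>I. \<forall>j\<in>I. le i j \<longrightarrow> p i j (x j) = x i}"

definition is_projective_limit ::
  "'i set \<Rightarrow> ('i \<Rightarrow> 'i \<Rightarrow> bool) \<Rightarrow> ('i \<Rightarrow> 'a topology) \<Rightarrow> ('i \<Rightarrow> 'i \<Rightarrow> 'a \<Rightarrow> 'a)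
     \<Rightarrow> 'b topology \<Rightarrow> ('i \<Rightarrow> 'b \<Rightarrow> 'a) \<Rightarrow> bool" where
  "is_projective_limit I le X p Y q \<longleftrightarrow>
     homeomorphic_map Y (canonical_limit I le X p) (\<lambda>y. \<lambda>i\<in>I. q i y)"


section \<open>The lower Vietoris hyperspace\<close>

definition HV :: "'a topology \<Rightarrow> 'a set topology" where
  "HV X = topology_generated_by
     {{C. closedin X C \<and> C \<noteq> {} \<and> C \<inter> U \<noteq> {}} | U. openin X U}"

definition HV_map :: "'b topology \<Rightarrow> ('a \<Rightarrow> 'b) \<Rightarrow> 'a set \<Rightarrow> 'b set" where
  "HV_map Y f C = Y closure_of (f ` C)"

lemma topspace_HV: "topspace (HV X) = {C. closedin X C \<and> C \<noteq> {}}"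
proof
  show "topspace (HV X) \<subseteq> {C. closedin X C \<and> C \<noteq> {}}"
    unfolding HV_def topology_generated_by_topspace by auto
next
  have "C \<inter> topspace X \<noteq> {}" if "closedin X C" "C \<noteq> {}" for C
    using that closedin_subset[of X C] by auto
  then have "{C. closedin X C \<and> C \<noteq> {}}
      \<subseteq> {C. closedin X C \<and> C \<noteq> {} \<and> C \<inter> topspace X \<noteq> {}}"
    by auto
  also have "\<dots> \<subseteq> topspace (HV X)"
    unfolding HV_def topology_generated_by_topspace
    by (rule Union_upper, rule CollectI, rule exI[of _ "topspace X"]) simp
  finally show "{C. closedin X C \<and> C \<noteq> {}} \<subseteq> topspace (HV X)" .
qed


section \<open>Quasi-lenses\<close>

definition quasi_lens :: "'a topology \<Rightarrow> 'a set \<times> 'a set \<Rightarrow> bool" where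
  "quasi_lens X = (\<lambda>(Q, C). compactin X Q \<and> saturatedin X Q \<and> closedin X C \<and>
     Q \<inter> C \<noteq> {} \<and> Q \<subseteq> up_closure X (Q \<inter> C) \<and>
     (\<forall>U. openin X U \<and> Q \<subseteq> U \<longrightarrow> C \<subseteq> X closure_of (U \<inter> C)))"

definition PqV :: "'a topology \<Rightarrow> ('a set \<times> 'a set) topology" where
  "PqV X = topology_generated_by
     ({{(Q, C). quasi_lens X (Q, C) \<and> Q \<subseteq> U} | U. openin X U} \<union>
      {{(Q, C). quasi_lens X (Q, C) \<and> C \<inter> U \<noteq> {}} | U. openin X U})"

definition PqV_map :: "'b topology \<Rightarrow> ('a \<Rightarrow> 'b) \<Rightarrow> 'a set \<times> 'a set \<Rightarrow> 'b set \<times> 'b set" where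
  "PqV_map Y f = (\<lambda>(Q, C). (up_closure Y (f ` Q), Y closure_of (f ` C)))"

lemma topspace_PqV: "topspace (PqV X) = {L. quasi_lens X L}"
proof
  show "topspace (PqV X) \<subseteq> {L. quasi_lens X L}"
    unfolding PqV_def topology_generated_by_topspace by auto
next
  have "{L. quasi_lens X L} \<subseteq> {(Q, C). quasi_lens X (Q, C) \<and> Q \<subseteq> topspace X}"
    by (auto simp: quasi_lens_def compactin_def)
  also have "\<dots> \<subseteq> topspace (PqV X)"
    unfolding PqV_def topology_generated_by_topspace
    by (rule Union_upper, rule UnI1, rule CollectI, rule exI[of _ "topspace X"]) simp
  finally show "{L. quasi_lens X L} \<subseteq> topspace (PqV X)" .
qed


section \<open>Valuations with values in the three-element chain\<close>

datatype three = A0 | AM | A1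

instantiation three :: complete_linorder
begin

fun rank_three :: "three \<Rightarrow> nat" where
  "rank_three A0 = 0" | "rank_three AM = 1" | "rank_three A1 = 2"

definition "a \<le> b \<longleftrightarrow> rank_three a \<le> rank_three b"
definition "a < b \<longleftrightarrow> rank_three a < rank_three b"
definition "bot = A0"
definition "top = A1"
definition "inf a b = (if a \<le> b then a else (b :: three))"
definition "sup a b = (if a \<le> b then b else (a :: three))"
definition "Sup S = (if A1 \<in> S then A1 else if AM \<in> S then AM else A0)"
definition "Inf S = (if A0 \<in> S then A0 else if AM \<in> S then AM else A1)"

instance
proof
  fix a b c :: three and S :: "three set"
  show "a < b \<longleftrightarrow> a \<le> b \<and> \<not> b \<le> a" "a \<le> a" "a \<le> b \<or> b \<le> a"
    by (auto simp: less_eq_three_def less_three_def)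
  show "a \<le> b \<Longrightarrow> b \<le> c \<Longrightarrow> a \<le> c"
    by (auto simp: less_eq_three_def)
  show "a \<le> b \<Longrightarrow> b \<le> a \<Longrightarrow> a = b"
    by (cases a; cases b; simp add: less_eq_three_def)
  show "inf a b \<le> a" "inf a b \<le> b" "a \<le> b \<Longrightarrow> a \<le> c \<Longrightarrow> a \<le> inf b c"
    "a \<le> sup a b" "b \<le> sup a b" "b \<le> a \<Longrightarrow> c \<le> a \<Longrightarrow> sup b c \<le> a"
    by (auto simp: inf_three_def sup_three_def less_eq_three_def)
  show "Inf {} = (top :: three)" "Sup {} = (bot :: three)"
    by (simp_all add: Inf_three_def Sup_three_def top_three_def bot_three_def)
  show "Inf S \<le> a" "a \<le> Sup S" if "a \<in> S"
    using that by (cases a; simp add: Inf_three_def Sup_three_def less_eq_three_def)+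
  show "a \<le> Inf S" if "\<And>x. x \<in> S \<Longrightarrow> a \<le> x"
    using that[of A0] that[of AM]
    by (cases a) (auto simp: Inf_three_def less_eq_three_def)
  show "Sup S \<le> a" if "\<And>x. x \<in> S \<Longrightarrow> x \<le> a"
    using that[of A1] that[of AM]
    by (cases a) (auto simp: Sup_three_def less_eq_three_def)
qed

end

text \<open>Maps on the open sets of \<open>X\<close> are functions on all sets that are \<open>undefined\<close> at
  non-open sets, so that equality is equality on the open sets.\<close>

definition scott_continuous_opens :: "'a topology \<Rightarrow> ('a set \<Rightarrow> three) \<Rightarrow> bool" where
  "scott_continuous_opens X \<alpha> \<longleftrightarrow>
     (\<forall>U V. openin X U \<and> openin X V \<and> U \<subseteq> V \<longrightarrow> \<alpha> U \<le> \<alpha> V) \<and>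
     (\<forall>D. (\<forall>U\<in>D. openin X U) \<and> directed_set D (\<subseteq>) \<longrightarrow> \<alpha> (\<Union>D) = (SUP U\<in>D. \<alpha> U))"

definition A_valuation :: "'a topology \<Rightarrow> ('a set \<Rightarrow> three) \<Rightarrow> bool" where
  "A_valuation X \<alpha> \<longleftrightarrow> \<alpha> \<in> extensional {U. openin X U} \<and> scott_continuous_opens X \<alpha> \<and>
     \<alpha> {} = A0 \<and> \<alpha> (topspace X) = A1 \<and>
     (\<forall>U V. openin X U \<and> openin X V \<and> \<alpha> U = A0 \<longrightarrow> \<alpha> (U \<union> V) = \<alpha> V) \<and>
     (\<forall>U V. openin X U \<and> openin X V \<and> \<alpha> V = A1 \<longrightarrow> \<alpha> (U \<inter> V) = \<alpha> U)"

definition PAV :: "'a topology \<Rightarrow> ('a set \<Rightarrow> three) topology" where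
  "PAV X = topology_generated_by
     ({{\<alpha>. A_valuation X \<alpha> \<and> \<alpha> U = A1} | U. openin X U} \<union>
      {{\<alpha>. A_valuation X \<alpha> \<and> \<alpha> U \<noteq> A0} | U. openin X U})"

definition PAV_map ::
  "'a topology \<Rightarrow> 'b topology \<Rightarrow> ('a \<Rightarrow> 'b) \<Rightarrow> ('a set \<Rightarrow> three) \<Rightarrow> 'b set \<Rightarrow> three" where
  "PAV_map X Y f \<alpha> = (\<lambda>V\<in>{V. openin Y V}. \<alpha> {x \<in> topspace X. f x \<in> V})"

lemma topspace_PAV: "topspace (PAV X) = {\<alpha>. A_valuation X \<alpha>}"
proof
  show "topspace (PAV X) \<subseteq> {\<alpha>. A_valuation X \<alpha>}"
    unfolding PAV_def topology_generated_by_topspace by auto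
next
  have "{\<alpha>. A_valuation X \<alpha>} \<subseteq> {\<alpha>. A_valuation X \<alpha> \<and> \<alpha> (topspace X) = A1}"
    by (auto simp: A_valuation_def)
  also have "\<dots> \<subseteq> topspace (PAV X)"
    unfolding PAV_def topology_generated_by_topspace
    by (rule Union_upper, rule UnI1, rule CollectI, rule exI[of _ "topspace X"]) simp
  finally show "{\<alpha>. A_valuation X \<alpha>} \<subseteq> topspace (PAV X)" .
qed

end

theory Submission
  imports Defs
begin

text \<open>
  A quasi-lens \<open>(Q, C)\<close> is known from its tests on open sets: which \<open>U\<close> contain \<open>Q\<close> and
  which \<open>U\<close> meet \<open>C\<close>. An \<open>A\<close>-valuation is known from its tests \<open>\<alpha> U = 1\<close> and \<open>\<alpha> U \<noteq> 0\<close>.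
  In both cases the axioms say three things: the opens passing the first test form a
  Scott-open filter, the second test is that of meeting a closed set, and the two tests are
  tied by the same three laws, called \<open>linked\<close> below (\<open>quasi_lens_iff_linked\<close>,
  \<open>A_valuation_iff_linked\<close>). The functors act by pulling tests back along inverse images.
  Both limit statements are thus one statement about pairs of tests.

  Every open set \<open>U\<close> of the limit is the directed union of the cylinders over \<open>under i U\<close>, the
  largest open sets of the factors whose cylinders lie in \<open>U\<close>. Compactness of \<open>Q\<close> and
  Scott-continuity of \<open>\<alpha>\<close> therefore make every test on \<open>U\<close> a disjunction of tests on cylinders.
  This gives injectivity of the comparison map and openness onto its image.

  The content lies in surjectivity. Given compatible tests on the factors, the closed set comes
  from the limit property of the lower Vietoris hyperspaces. The compact set is the \<open>kernel\<close> of
  the compatible Scott-open filters \<open>F i\<close>: the points of the limit whose \<open>i\<close>-th coordinate lies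
  in every member of \<open>F i\<close>. That it is compact, and that its neighbourhoods give back the
  filters, rests on one existence statement, \<open>avoiding_point\<close>: if open sets \<open>W i\<close> outside
  \<open>F i\<close> are compatible with the bonding maps, then the kernel has a point whose coordinates all
  avoid the \<open>W i\<close>. For a single space this is the Hofmann-Mislove theorem, and for neighbourhood
  filters of compact sets it is Steenrod's theorem that projective limits of non-empty compact
  sober spaces are non-empty. The proof enlarges the \<open>W i\<close> to a maximal such family by Zorn's
  lemma; maximality makes the complements irreducible and makes their generic points, which
  exist by sobriety, compatible.

  Finally, the linking laws pass from the factors to the limit (\<open>quasi_lens_kernel\<close>), since an
  instance of a law on the limit already occurs at some index.
\<close>

section \<open>Saturated sets, closed sets and the open sets they meet\<close>

lemma saturatedin_up_closure: "saturatedin X (up_closure X A)"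
  unfolding saturatedin_def up_closure_def
  by (auto simp: spec_le_def)

lemma up_closure_subset_open_iff:
  assumes "A \<subseteq> topspace X" "openin X U"
  shows "up_closure X A \<subseteq> U \<longleftrightarrow> A \<subseteq> U"
  using assms unfolding up_closure_def spec_le_def by blast

text \<open>If \<open>x \<notin> A\<close>, then no point of \<open>A\<close> is below \<open>x\<close>, so the complement of the closure of \<open>x\<close> is an
open neighbourhood of \<open>A\<close> that misses \<open>x\<close>. Hence a saturated set is the intersection of its
open neighbourhoods.\<close>

lemma saturatedin_contains_iff:
  assumes "saturatedin X A" "x \<in> topspace X"
  shows "x \<in> A \<longleftrightarrow> (\<forall>U. openin X U \<and> A \<subseteq> U \<longrightarrow> x \<in> U)"
proof
  assume all: "\<forall>U. openin X U \<and> A \<subseteq> U \<longrightarrow> x \<in> U"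
  show "x \<in> A"
  proof (rule ccontr)
    assume "x \<notin> A"
    have "A \<subseteq> topspace X - X closure_of {x}"
    proof
      fix a assume a: "a \<in> A"
      then have "a \<in> topspace X" "\<not> spec_le X a x"
        using assms \<open>x \<notin> A\<close> by (auto simp: saturatedin_def)
      then show "a \<in> topspace X - X closure_of {x}"
        using assms by (auto simp: spec_le_def in_closure_of)
    qed
    then have "x \<in> topspace X - X closure_of {x}"
      using all openin_diff[OF openin_topspace closedin_closure_of] by metis
    then show False
      using assms(2) by (simp add: in_closure_of)
  qed
next
  assume "x \<in> A"
  then show "\<forall>U. openin X U \<and> A \<subseteq> U \<longrightarrow> x \<in> U" by (simp add: subset_iff)
qed

lemma saturatedin_eqI:
  assumes "saturatedin X A" "saturatedin X B"
    and "\<And>U. openin X U \<Longrightarrow> A \<subseteq> U \<longleftrightarrow> B \<subseteq> U"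
  shows "A = B"
proof -
  have "A \<subseteq> topspace X" "B \<subseteq> topspace X"
    using assms by (auto simp: saturatedin_def)
  moreover have "x \<in> A \<longleftrightarrow> x \<in> B" if "x \<in> topspace X" for x
    unfolding saturatedin_contains_iff[OF assms(1) that] saturatedin_contains_iff[OF assms(2) that]
    using assms(3) by auto
  ultimately show ?thesis by (auto simp: subset_iff)
qed

lemma closure_of_meets_open_iff:
  assumes "A \<subseteq> topspace X" "openin X U"
  shows "(X closure_of A) \<inter> U \<noteq> {} \<longleftrightarrow> A \<inter> U \<noteq> {}"
  using openin_Int_closure_of_eq_empty[OF assms(2), of A] by blast

lemma closedin_eqI:
  assumes "closedin X A" "closedin X B"
    and "\<And>U. openin X U \<Longrightarrow> A \<inter> U \<noteq> {} \<longleftrightarrow> B \<inter> U \<noteq> {}"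
  shows "A = B"
proof -
  have "A \<inter> (topspace X - B) = {}" "B \<inter> (topspace X - A) = {}"
    using assms(3)[OF openin_diff[OF openin_topspace assms(2)]]
      assms(3)[OF openin_diff[OF openin_topspace assms(1)]] by auto
  then show ?thesis
    using closedin_subset[OF assms(1)] closedin_subset[OF assms(2)] by blast
qed

section \<open>Compactness and Scott-open filters\<close>

text \<open>The improper filter of all open sets counts as a Scott-open filter: it is the neighbourhood
filter of the empty compact set.\<close>

definition scott_open_filter :: "'a topology \<Rightarrow> 'a set set \<Rightarrow> bool" where
  "scott_open_filter X F \<longleftrightarrow>
     (\<forall>U\<in>F. openin X U) \<and> topspace X \<in> F \<and>
     (\<forall>U V. U \<in> F \<and> openin X V \<and> U \<subseteq> V \<longrightarrow> V \<in> F) \<and>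
     (\<forall>U\<in>F. \<forall>V\<in>F. U \<inter> V \<in> F) \<and>
     (\<forall>D. (\<forall>U\<in>D. openin X U) \<and> directed_set D (\<subseteq>) \<and> \<Union>D \<in> F \<longrightarrow> (\<exists>U\<in>D. U \<in> F))"

lemma scott_open_filterD:
  assumes "scott_open_filter X F"
  shows "U \<in> F \<Longrightarrow> openin X U" "topspace X \<in> F"
    "U \<in> F \<Longrightarrow> openin X V \<Longrightarrow> U \<subseteq> V \<Longrightarrow> V \<in> F"
    "U \<in> F \<Longrightarrow> V \<in> F \<Longrightarrow> U \<inter> V \<in> F"
    "(\<And>U. U \<in> D \<Longrightarrow> openin X U) \<Longrightarrow> directed_set D (\<subseteq>) \<Longrightarrow> \<Union>D \<in> F \<Longrightarrow> \<exists>U\<in>D. U \<in> F"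
proof -
  note F = assms[unfolded scott_open_filter_def]
  show "U \<in> F \<Longrightarrow> openin X U" "topspace X \<in> F" "U \<in> F \<Longrightarrow> V \<in> F \<Longrightarrow> U \<inter> V \<in> F"
    using F[THEN conjunct1] F[THEN conjunct2, THEN conjunct1]
      F[THEN conjunct2, THEN conjunct2, THEN conjunct2, THEN conjunct1] by auto
  show "U \<in> F \<Longrightarrow> openin X V \<Longrightarrow> U \<subseteq> V \<Longrightarrow> V \<in> F"
    using F[THEN conjunct2, THEN conjunct2, THEN conjunct1] by blast
  have "(\<forall>U\<in>D. openin X U) \<and> directed_set D (\<subseteq>) \<and> \<Union>D \<in> F \<longrightarrow> (\<exists>U\<in>D. U \<in> F)"
    using F[THEN conjunct2, THEN conjunct2, THEN conjunct2, THEN conjunct2] by (rule spec)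
  then show "(\<And>U. U \<in> D \<Longrightarrow> openin X U) \<Longrightarrow> directed_set D (\<subseteq>) \<Longrightarrow> \<Union>D \<in> F \<Longrightarrow> \<exists>U\<in>D. U \<in> F"
    by simp
qed

lemma directed_set_finite_upper_bound:
  assumes dir: "directed_set I le" and tr: "transp_on I le"
    and "finite J" "J \<subseteq> I"
  shows "\<exists>k\<in>I. \<forall>j\<in>J. le j k"
  using assms(3,4)
proof (induction J rule: finite_induct)
  case empty
  then show ?case using dir by (auto simp: directed_set_def)
next
  case (insert a J)
  then obtain k where k: "k \<in> I" "\<forall>j\<in>J. le j k" by auto
  moreover obtain m where "m \<in> I" "le a m" "le k m"
    using dir insert.prems k unfolding directed_set_def by blast
  moreover have "le j m" if "j \<in> J" for j
    using transp_onD[OF tr, of j k m] insert.prems calculation that by auto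
  ultimately show ?case by auto
qed

lemma directed_set_image_mono:
  assumes "directed_set I le"
    and "\<And>i j. i \<in> I \<Longrightarrow> j \<in> I \<Longrightarrow> le i j \<Longrightarrow> f i \<subseteq> f j"
  shows "directed_set (f ` I) (\<subseteq>)"
  unfolding directed_set_def
proof (intro conjI ballI)
  show "f ` I \<noteq> {}" using assms(1) by (simp add: directed_set_def)
  fix A B assume "A \<in> f ` I" "B \<in> f ` I"
  then obtain i j where ij: "i \<in> I" "j \<in> I" "A = f i" "B = f j" by auto
  then obtain k where "k \<in> I" "le i k" "le j k"
    using assms(1) unfolding directed_set_def by auto
  then show "\<exists>C\<in>f ` I. A \<subseteq> C \<and> B \<subseteq> C"
    using assms(2) ij by auto
qed

lemma compactin_directedD:
  assumes "compactin X Q" "\<And>U. U \<in> D \<Longrightarrow> openin X U" "directed_set D (\<subseteq>)" "Q \<subseteq> \<Union>D"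
  shows "\<exists>U\<in>D. Q \<subseteq> U"
proof -
  obtain E where E: "finite E" "E \<subseteq> D" "Q \<subseteq> \<Union>E"
    using compactinD[OF assms(1,2,4)] by metis
  have "transp_on D (\<subseteq>)"
    by (auto simp: transp_on_def)
  from directed_set_finite_upper_bound[OF assms(3) this E(1,2)]
  obtain U where U: "U \<in> D" "\<forall>V\<in>E. V \<subseteq> U" by auto
  then have "\<Union>E \<subseteq> U" by auto
  then have "Q \<subseteq> U" using E(3) by (rule subset_trans[rotated])
  then show ?thesis using U(1) by (rule bexI)
qed

text \<open>An open cover is made directed by closing it under finite unions.\<close>

lemma compactin_directedI:
  assumes "Q \<subseteq> topspace X"
    and dir: "\<And>D. (\<And>U. U \<in> D \<Longrightarrow> openin X U) \<Longrightarrow> directed_set D (\<subseteq>) \<Longrightarrow> Q \<subseteq> \<Union>D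
           \<Longrightarrow> \<exists>U\<in>D. Q \<subseteq> U"
  shows "compactin X Q"
  unfolding compactin_def
proof (intro conjI allI impI assms(1))
  fix \<U> assume U: "Ball \<U> (openin X) \<and> Q \<subseteq> \<Union>\<U>"
  define D where "D = {\<Union>E | E. finite E \<and> E \<subseteq> \<U>}"
  have opn: "openin X U" if "U \<in> D" for U
    using that U unfolding D_def by blast
  have "directed_set D (\<subseteq>)"
    unfolding directed_set_def
  proof (intro conjI ballI)
    show "D \<noteq> {}" unfolding D_def by blast
    fix A B assume "A \<in> D" "B \<in> D"
    then obtain E E' where "A = \<Union>E" "B = \<Union>E'" "finite (E \<union> E')" "E \<union> E' \<subseteq> \<U>"
      unfolding D_def by auto
    then show "\<exists>C\<in>D. A \<subseteq> C \<and> B \<subseteq> C"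
      unfolding D_def by (intro bexI[of _ "\<Union>(E \<union> E')"]) blast+
  qed
  moreover have "Q \<subseteq> \<Union>D"
  proof
    fix x assume "x \<in> Q"
    then obtain V where "V \<in> \<U>" "x \<in> V" using U by blast
    moreover have "V \<in> D" unfolding D_def using \<open>V \<in> \<U>\<close>
      by (intro CollectI exI[of _ "{V}"]) auto
    ultimately show "x \<in> \<Union>D" by blast
  qed
  ultimately obtain V where "V \<in> D" "Q \<subseteq> V"
    using dir[of D] opn by auto
  then show "\<exists>\<F>. finite \<F> \<and> \<F> \<subseteq> \<U> \<and> Q \<subseteq> \<Union>\<F>"
    unfolding D_def by auto
qed

lemma scott_open_filter_neighbourhoods:
  assumes "compactin X Q"
  shows "scott_open_filter X {U. openin X U \<and> Q \<subseteq> U}"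
  unfolding scott_open_filter_def
proof (intro conjI allI impI ballI)
  fix D assume "(\<forall>U\<in>D. openin X U) \<and> directed_set D (\<subseteq>) \<and> \<Union>D \<in> {U. openin X U \<and> Q \<subseteq> U}"
  then show "\<exists>U\<in>D. U \<in> {U. openin X U \<and> Q \<subseteq> U}"
    using compactin_directedD[OF assms, of D] by auto
qed (use compactin_subset_topspace[OF assms] in \<open>auto intro!: openin_Int\<close>)

section \<open>Quasi-lenses and valuations through their tests on open sets\<close>

text \<open>Read \<open>N U\<close> as ``surely in \<open>U\<close>'' (\<open>Q \<subseteq> U\<close>, or \<open>\<alpha> U = 1\<close>) and \<open>H U\<close> as ``possibly in \<open>U\<close>''
(\<open>C \<inter> U \<noteq> {}\<close>, or \<open>\<alpha> U \<noteq> 0\<close>). The laws are those that modal logic imposes on a necessity and a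
possibility operator.\<close>

definition linked :: "'a topology \<Rightarrow> ('a set \<Rightarrow> bool) \<Rightarrow> ('a set \<Rightarrow> bool) \<Rightarrow> bool" where
  "linked X N H \<longleftrightarrow>
     (\<forall>U. openin X U \<and> N U \<longrightarrow> H U) \<and>
     (\<forall>U V. openin X U \<and> openin X V \<and> \<not> H U \<and> N (U \<union> V) \<longrightarrow> N V) \<and>
     (\<forall>U V. openin X U \<and> openin X V \<and> N U \<and> H V \<longrightarrow> H (U \<inter> V))"

lemma linkedD:
  assumes "linked X N H" "openin X U"
  shows "N U \<Longrightarrow> H U"
    "openin X V \<Longrightarrow> \<not> H U \<Longrightarrow> N (U \<union> V) \<Longrightarrow> N V"
    "openin X V \<Longrightarrow> N U \<Longrightarrow> H V \<Longrightarrow> H (U \<inter> V)"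
  using assms unfolding linked_def by blast+

lemma linked_cong:
  assumes "\<And>U. openin X U \<Longrightarrow> N U = N' U" "\<And>U. openin X U \<Longrightarrow> H U = H' U"
  shows "linked X N H = linked X N' H'"
  using assms unfolding linked_def by (simp add: openin_Un openin_Int cong: conj_cong)

lemma linked_vimage:
  assumes "linked X N H" "continuous_map X Y f"
  shows "linked Y (\<lambda>V. N {x \<in> topspace X. f x \<in> V}) (\<lambda>V. H {x \<in> topspace X. f x \<in> V})"
proof -
  have o: "openin X {x \<in> topspace X. f x \<in> V}" if "openin Y V" for V
    using assms(2) that by (rule openin_continuous_map_preimage)
  have u: "{x \<in> topspace X. f x \<in> U \<union> V} = {x \<in> topspace X. f x \<in> U} \<union> {x \<in> topspace X. f x \<in> V}"
    and i: "{x \<in> topspace X. f x \<in> U \<inter> V} = {x \<in> topspace X. f x \<in> U} \<inter> {x \<in> topspace X. f x \<in> V}"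
    for U V by auto
  show ?thesis
    unfolding linked_def u i
    by (intro conjI allI impI; elim conjE;
        blast intro: o linkedD(1)[OF assms(1)] linkedD(2)[OF assms(1) o] linkedD(3)[OF assms(1) o])
qed

lemma subset_up_closure_iff:
  assumes "Q \<subseteq> topspace X" "A \<subseteq> topspace X"
  shows "Q \<subseteq> up_closure X A \<longleftrightarrow> (\<forall>V. openin X V \<and> A \<subseteq> V \<longrightarrow> Q \<subseteq> V)"
proof -
  have "x \<in> up_closure X A \<longleftrightarrow> (\<forall>V. openin X V \<and> A \<subseteq> V \<longrightarrow> x \<in> V)" if "x \<in> Q" for x
    using saturatedin_contains_iff[OF saturatedin_up_closure, of x X A]
      up_closure_subset_open_iff[OF assms(2)] that assms(1) by blast
  then show ?thesis by blast
qed

text \<open>The three laws are the three axioms of a quasi-lens, in order: the first, for the complement of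
\<open>C\<close>, says that \<open>Q\<close> meets \<open>C\<close>; the second, for the same open set, says that every open
neighbourhood of \<open>Q \<inter> C\<close> contains \<open>Q\<close>, which is \<open>Q \<subseteq> \<up>(Q \<inter> C)\<close> because saturated sets are
intersections of open sets; the third is the density condition spelled out.\<close>

lemma quasi_lens_iff_linked:
  "quasi_lens X (Q, C) \<longleftrightarrow> compactin X Q \<and> saturatedin X Q \<and> closedin X C \<and>
     linked X (\<lambda>U. Q \<subseteq> U) (\<lambda>U. C \<inter> U \<noteq> {})"
proof (cases "compactin X Q \<and> saturatedin X Q \<and> closedin X C")
  case True
  then have Q: "Q \<subseteq> topspace X" and C: "closedin X C" "C \<subseteq> topspace X"
    by (auto simp: compactin_def closedin_subset)
  have oC: "openin X (topspace X - C)" using openin_diff[OF openin_topspace C(1)] .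
  have "Q \<inter> C \<noteq> {} \<longleftrightarrow> (\<forall>U. openin X U \<and> Q \<subseteq> U \<longrightarrow> C \<inter> U \<noteq> {})"
    using oC Q by blast
  moreover have "Q \<subseteq> up_closure X (Q \<inter> C) \<longleftrightarrow>
      (\<forall>U V. openin X U \<and> openin X V \<and> \<not> C \<inter> U \<noteq> {} \<and> Q \<subseteq> U \<union> V \<longrightarrow> Q \<subseteq> V)" (is "_ = ?R")
  proof -
    have "Q \<subseteq> up_closure X (Q \<inter> C) \<longleftrightarrow> (\<forall>V. openin X V \<and> Q \<inter> C \<subseteq> V \<longrightarrow> Q \<subseteq> V)"
      using Q by (intro subset_up_closure_iff) auto
    also have "\<dots> \<longleftrightarrow> ?R"
    proof
      assume R: ?R
      show "\<forall>V. openin X V \<and> Q \<inter> C \<subseteq> V \<longrightarrow> Q \<subseteq> V"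
      proof (intro allI impI)
        fix V assume V: "openin X V \<and> Q \<inter> C \<subseteq> V"
        then have "Q \<subseteq> (topspace X - C) \<union> V" using Q by blast
        then show "Q \<subseteq> V" using R oC V by blast
      qed
    qed blast
    finally show ?thesis .
  qed
  moreover have "(\<forall>U. openin X U \<and> Q \<subseteq> U \<longrightarrow> C \<subseteq> X closure_of (U \<inter> C)) \<longleftrightarrow>
      (\<forall>U V. openin X U \<and> openin X V \<and> Q \<subseteq> U \<and> C \<inter> V \<noteq> {} \<longrightarrow> C \<inter> (U \<inter> V) \<noteq> {})"
  proof -
    have *: "C \<subseteq> X closure_of A \<longleftrightarrow> (\<forall>V. openin X V \<and> C \<inter> V \<noteq> {} \<longrightarrow> A \<inter> V \<noteq> {})" for A
      using C(2) unfolding subset_iff in_closure_of disjoint_iff by meson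
    show ?thesis unfolding * by (simp add: Int_ac) blast
  qed
  ultimately show ?thesis
    using True unfolding quasi_lens_def linked_def by simp
next
  case False
  then show ?thesis by (auto simp: quasi_lens_def)
qed

lemma compactin_up_closure:
  assumes "compactin X A"
  shows "compactin X (up_closure X A)"
proof (rule compactin_directedI)
  show "up_closure X A \<subseteq> topspace X"
    by (auto simp: up_closure_def spec_le_def)
  fix D assume D: "\<And>U. U \<in> D \<Longrightarrow> openin X U" "directed_set D (\<subseteq>)" "up_closure X A \<subseteq> \<Union>D"
  have "A \<subseteq> \<Union>D"
    using D(1,3) up_closure_subset_open_iff[OF compactin_subset_topspace[OF assms], of "\<Union>D"]
    by blast
  then show "\<exists>U\<in>D. up_closure X A \<subseteq> U"
    using compactin_directedD[OF assms D(1,2)] D(1)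
      up_closure_subset_open_iff[OF compactin_subset_topspace[OF assms]] by blast
qed

lemma PqV_map_tests:
  assumes f: "continuous_map X Y f" and L: "quasi_lens X L" and V: "openin Y V"
  shows "fst (PqV_map Y f L) \<subseteq> V \<longleftrightarrow> fst L \<subseteq> {x \<in> topspace X. f x \<in> V}"
    and "snd (PqV_map Y f L) \<inter> V \<noteq> {} \<longleftrightarrow> snd L \<inter> {x \<in> topspace X. f x \<in> V} \<noteq> {}"
proof -
  obtain Q C where L_eq: "L = (Q, C)" by fastforce
  have Q: "Q \<subseteq> topspace X" and C: "C \<subseteq> topspace X"
    using L by (auto simp: L_eq quasi_lens_def compactin_def closedin_subset)
  have "f ` Q \<subseteq> topspace Y" "f ` C \<subseteq> topspace Y"
    using f Q C by (auto simp: continuous_map_def)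
  note * = up_closure_subset_open_iff[OF this(1) V] closure_of_meets_open_iff[OF this(2) V]
  show "fst (PqV_map Y f L) \<subseteq> V \<longleftrightarrow> fst L \<subseteq> {x \<in> topspace X. f x \<in> V}"
    unfolding L_eq PqV_map_def fst_conv prod.case *(1) using Q by blast
  show "snd (PqV_map Y f L) \<inter> V \<noteq> {} \<longleftrightarrow> snd L \<inter> {x \<in> topspace X. f x \<in> V} \<noteq> {}"
    unfolding L_eq PqV_map_def snd_conv prod.case *(2) using C by blast
qed

lemma quasi_lens_PqV_map:
  assumes f: "continuous_map X Y f" and L: "quasi_lens X L"
  shows "quasi_lens Y (PqV_map Y f L)"
proof -
  obtain Q C where L_eq: "L = (Q, C)" by fastforce
  then have q: "quasi_lens X (Q, C)" using L by simp
  then have "linked X (\<lambda>U. Q \<subseteq> U) (\<lambda>U. C \<inter> U \<noteq> {})" "compactin X Q"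
    by (auto simp: quasi_lens_iff_linked)
  have "linked Y (\<lambda>V. up_closure Y (f ` Q) \<subseteq> V) (\<lambda>V. (Y closure_of (f ` C)) \<inter> V \<noteq> {})"
    using linked_vimage[OF \<open>linked X _ _\<close> f] PqV_map_tests[OF f q]
    by (simp add: PqV_map_def cong: linked_cong)
  moreover have "compactin Y (up_closure Y (f ` Q))"
    using image_compactin[OF \<open>compactin X Q\<close> f] by (rule compactin_up_closure)
  ultimately show ?thesis
    by (simp add: L_eq PqV_map_def quasi_lens_iff_linked saturatedin_up_closure)
qed

lemma three_eqI: "(a = A1 \<longleftrightarrow> b = A1) \<Longrightarrow> (a \<noteq> A0 \<longleftrightarrow> b \<noteq> A0) \<Longrightarrow> a = (b :: three)"
  by (cases a; cases b; simp)

lemma three_le_iff: "a \<le> b \<longleftrightarrow> (a = A1 \<longrightarrow> b = A1) \<and> (a \<noteq> A0 \<longrightarrow> b \<noteq> A0)"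
  by (cases a; cases b; simp add: less_eq_three_def)

lemma Sup_three_eq_A1_iff: "Sup S = A1 \<longleftrightarrow> A1 \<in> S"
  and Sup_three_neq_A0_iff: "Sup S \<noteq> A0 \<longleftrightarrow> (\<exists>a\<in>S. a \<noteq> A0)"
  by (auto simp: Sup_three_def) (metis three.exhaust)

text \<open>The closed set is the complement of the largest open set with value \<open>0\<close>: opens of value \<open>0\<close>
are closed under binary unions by the first valuation law, hence under arbitrary unions by
Scott-continuity. Conversely, meeting a closed set preserves all unions, so Scott-continuity
only concerns the value \<open>1\<close>.\<close>

lemma A_valuation_iff_linked:
  "A_valuation X \<alpha> \<longleftrightarrow> \<alpha> \<in> extensional {U. openin X U} \<and>
     scott_open_filter X {U. openin X U \<and> \<alpha> U = A1} \<and>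
     (\<exists>C. closedin X C \<and> (\<forall>U. openin X U \<longrightarrow> (\<alpha> U \<noteq> A0 \<longleftrightarrow> C \<inter> U \<noteq> {}))) \<and>
     linked X (\<lambda>U. \<alpha> U = A1) (\<lambda>U. \<alpha> U \<noteq> A0)" (is "_ \<longleftrightarrow> ?R")
proof
  assume "A_valuation X \<alpha>"
  then have ext: "\<alpha> \<in> extensional {U. openin X U}"
    and mono: "\<And>U V. openin X U \<Longrightarrow> openin X V \<Longrightarrow> U \<subseteq> V \<Longrightarrow> \<alpha> U \<le> \<alpha> V"
    and sup: "\<And>D. (\<And>U. U \<in> D \<Longrightarrow> openin X U) \<Longrightarrow> directed_set D (\<subseteq>) \<Longrightarrow> \<alpha> (\<Union>D) = (SUP U\<in>D. \<alpha> U)"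
    and e: "\<alpha> {} = A0" and t: "\<alpha> (topspace X) = A1"
    and z: "\<And>U V. openin X U \<Longrightarrow> openin X V \<Longrightarrow> \<alpha> U = A0 \<Longrightarrow> \<alpha> (U \<union> V) = \<alpha> V"
    and o: "\<And>U V. openin X U \<Longrightarrow> openin X V \<Longrightarrow> \<alpha> V = A1 \<Longrightarrow> \<alpha> (U \<inter> V) = \<alpha> U"
    unfolding A_valuation_def scott_continuous_opens_def by simp_all
  have "scott_open_filter X {U. openin X U \<and> \<alpha> U = A1}"
    unfolding scott_open_filter_def
  proof (intro conjI allI impI ballI)
    fix D assume D: "(\<forall>U\<in>D. openin X U) \<and> directed_set D (\<subseteq>) \<and> \<Union>D \<in> {U. openin X U \<and> \<alpha> U = A1}"
    then have "(SUP U\<in>D. \<alpha> U) = A1" using sup[of D] by simp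
    then show "\<exists>U\<in>D. U \<in> {U. openin X U \<and> \<alpha> U = A1}"
      using D unfolding Sup_three_eq_A1_iff by (metis (mono_tags, lifting) imageE mem_Collect_eq)
  qed (use t o mono three_le_iff in \<open>auto simp: openin_Int\<close>)
  moreover have "\<exists>C. closedin X C \<and> (\<forall>U. openin X U \<longrightarrow> (\<alpha> U \<noteq> A0 \<longleftrightarrow> C \<inter> U \<noteq> {}))"
  proof -
    define Z where "Z = {U. openin X U \<and> \<alpha> U = A0}"
    have "directed_set Z (\<subseteq>)"
      unfolding directed_set_def
    proof (intro conjI ballI)
      have "{} \<in> Z" using e by (simp add: Z_def)
      then show "Z \<noteq> {}" by auto
      fix U V assume "U \<in> Z" "V \<in> Z"
      then have "U \<union> V \<in> Z" using z unfolding Z_def by auto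
      then show "\<exists>W\<in>Z. U \<subseteq> W \<and> V \<subseteq> W" by blast
    qed
    then have "\<alpha> (\<Union>Z) = (SUP U\<in>Z. \<alpha> U)" by (intro sup) (auto simp: Z_def)
    moreover have "\<not> (SUP U\<in>Z. \<alpha> U) \<noteq> A0"
      unfolding Sup_three_neq_A0_iff by (auto simp: Z_def)
    ultimately have UZ: "\<alpha> (\<Union>Z) = A0" by simp
    have oZ: "openin X (\<Union>Z)" by (auto simp: Z_def)
    have "\<alpha> U \<noteq> A0 \<longleftrightarrow> (topspace X - \<Union>Z) \<inter> U \<noteq> {}" if U: "openin X U" for U
    proof -
      have "\<alpha> U = A0 \<longleftrightarrow> U \<subseteq> \<Union>Z"
        using U UZ mono[OF U oZ] three_le_iff unfolding Z_def by auto
      then show ?thesis using openin_subset[OF U] by blast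
    qed
    then show ?thesis using closedin_diff[OF closedin_topspace oZ] by metis
  qed
  moreover have "linked X (\<lambda>U. \<alpha> U = A1) (\<lambda>U. \<alpha> U \<noteq> A0)"
  proof -
    have "\<alpha> (U \<inter> V) = \<alpha> V" if "openin X U" "openin X V" "\<alpha> U = A1" for U V
      using o[of V U] that by (simp add: Int_commute)
    then show ?thesis unfolding linked_def using z by auto
  qed
  ultimately show ?R using ext by blast
next
  assume R: ?R
  then obtain C where C: "closedin X C" "\<And>U. openin X U \<Longrightarrow> \<alpha> U \<noteq> A0 \<longleftrightarrow> C \<inter> U \<noteq> {}"
    by blast
  from R have F: "scott_open_filter X {U. openin X U \<and> \<alpha> U = A1}"
    and L: "linked X (\<lambda>U. \<alpha> U = A1) (\<lambda>U. \<alpha> U \<noteq> A0)"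
    and ext: "\<alpha> \<in> extensional {U. openin X U}" by auto
  have mono: "\<alpha> U \<le> \<alpha> V" if "openin X U" "openin X V" "U \<subseteq> V" for U V
    unfolding three_le_iff using that C(2) scott_open_filterD(3)[OF F, of U V] by auto
  have sup: "\<alpha> (\<Union>D) = (SUP U\<in>D. \<alpha> U)" if D: "\<forall>U\<in>D. openin X U" "directed_set D (\<subseteq>)" for D
  proof (rule three_eqI)
    have oD: "openin X (\<Union>D)" using D by blast
    have "A1 \<in> \<alpha> ` D" if "\<alpha> (\<Union>D) = A1"
      using scott_open_filterD(5)[OF F, of D] D oD that by force
    moreover have "\<alpha> (\<Union>D) = A1" if "A1 \<in> \<alpha> ` D"
      using that mono[OF _ oD] D oD three_le_iff by (metis Union_upper image_iff)
    ultimately show "\<alpha> (\<Union>D) = A1 \<longleftrightarrow> (SUP U\<in>D. \<alpha> U) = A1"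
      unfolding Sup_three_eq_A1_iff by blast
    show "\<alpha> (\<Union>D) \<noteq> A0 \<longleftrightarrow> (SUP U\<in>D. \<alpha> U) \<noteq> A0"
      unfolding Sup_three_neq_A0_iff using C(2)[OF oD] C(2) D by auto
  qed
  have "\<alpha> {} = A0" using C(2)[of "{}"] by auto
  moreover have "\<alpha> (topspace X) = A1" using scott_open_filterD(2)[OF F] by auto
  moreover have "\<alpha> (U \<union> V) = \<alpha> V" if UV: "openin X U" "openin X V" "\<alpha> U = A0" for U V
  proof (rule three_eqI)
    show "\<alpha> (U \<union> V) = A1 \<longleftrightarrow> \<alpha> V = A1"
      using linkedD(2)[OF L UV(1,2)] UV mono[of V "U \<union> V"] three_le_iff by auto
    show "\<alpha> (U \<union> V) \<noteq> A0 \<longleftrightarrow> \<alpha> V \<noteq> A0"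
      using UV C(2)[of "U \<union> V"] C(2)[of U] C(2)[of V] by auto
  qed
  moreover have "\<alpha> (U \<inter> V) = \<alpha> U" if UV: "openin X U" "openin X V" "\<alpha> V = A1" for U V
  proof (rule three_eqI)
    have le: "\<alpha> (U \<inter> V) \<le> \<alpha> U" using UV by (intro mono) auto
    show "\<alpha> (U \<inter> V) = A1 \<longleftrightarrow> \<alpha> U = A1"
      using scott_open_filterD(4)[OF F, of U V] UV le three_le_iff by auto
    show "\<alpha> (U \<inter> V) \<noteq> A0 \<longleftrightarrow> \<alpha> U \<noteq> A0"
      using linkedD(3)[OF L UV(2,1,3)] le three_le_iff by (auto simp: Int_commute)
  qed
  ultimately show "A_valuation X \<alpha>"
    unfolding A_valuation_def scott_continuous_opens_def using ext mono sup by simp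
qed

text \<open>By the first linking law every \<open>U\<close> that contains \<open>Q\<close> meets \<open>C\<close>, so the two tests can be read off
one map into the three-element chain.\<close>

lemma A_valuation_of_quasi_lens:
  assumes L: "quasi_lens X (Q, C)"
  shows "\<exists>\<alpha>. A_valuation X \<alpha> \<and> (\<forall>U. openin X U \<longrightarrow>
    (\<alpha> U = A1 \<longleftrightarrow> Q \<subseteq> U) \<and> (\<alpha> U \<noteq> A0 \<longleftrightarrow> C \<inter> U \<noteq> {}))"
proof -
  from L have Q: "compactin X Q" and C: "closedin X C"
    and link: "linked X (\<lambda>U. Q \<subseteq> U) (\<lambda>U. C \<inter> U \<noteq> {})"
    by (simp_all add: quasi_lens_iff_linked)
  define \<alpha> where "\<alpha> = (\<lambda>U\<in>{U. openin X U}. if Q \<subseteq> U then A1 else if C \<inter> U \<noteq> {} then AM else A0)"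
  have 1: "\<alpha> U = A1 \<longleftrightarrow> Q \<subseteq> U" if "openin X U" for U
    using that by (simp add: \<alpha>_def)
  have 2: "\<alpha> U \<noteq> A0 \<longleftrightarrow> C \<inter> U \<noteq> {}" if "openin X U" for U
    using that linkedD(1)[OF link that] by (simp add: \<alpha>_def)
  have "{U. openin X U \<and> \<alpha> U = A1} = {U. openin X U \<and> Q \<subseteq> U}"
    using 1 by auto
  moreover have "linked X (\<lambda>U. \<alpha> U = A1) (\<lambda>U. \<alpha> U \<noteq> A0)"
    using link linked_cong[of X "\<lambda>U. \<alpha> U = A1" "\<lambda>U. Q \<subseteq> U", OF 1 2] by simp
  moreover have "\<alpha> \<in> extensional {U. openin X U}" by (simp add: \<alpha>_def)
  ultimately have "A_valuation X \<alpha>"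
    unfolding A_valuation_iff_linked
    using scott_open_filter_neighbourhoods[OF Q] C 2 by auto
  then show ?thesis using 1 2 by (intro exI[of _ \<alpha>]) simp
qed

lemma scott_open_filter_vimage:
  assumes F: "scott_open_filter X F" and f: "continuous_map X Y f"
  shows "scott_open_filter Y {V. openin Y V \<and> {x \<in> topspace X. f x \<in> V} \<in> F}"
proof -
  let ?g = "\<lambda>V. {x \<in> topspace X. f x \<in> V}"
  have o: "openin X (?g V)" if "openin Y V" for V
    using f that by (rule openin_continuous_map_preimage)
  have top: "?g (topspace Y) = topspace X"
    using f by (auto simp: continuous_map_def)
  show ?thesis
    unfolding scott_open_filter_def
  proof (intro conjI allI impI ballI)
    show "topspace Y \<in> {V. openin Y V \<and> ?g V \<in> F}"
      using top scott_open_filterD(2)[OF F] by simp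
    fix U V assume "U \<in> {V. openin Y V \<and> ?g V \<in> F} \<and> openin Y V \<and> U \<subseteq> V"
    then show "V \<in> {V. openin Y V \<and> ?g V \<in> F}"
      using scott_open_filterD(3)[OF F, of "?g U" "?g V"] o[of V] by auto
  next
    fix U V assume UV: "U \<in> {V. openin Y V \<and> ?g V \<in> F}" "V \<in> {V. openin Y V \<and> ?g V \<in> F}"
    moreover have "?g (U \<inter> V) = ?g U \<inter> ?g V" by auto
    ultimately show "U \<inter> V \<in> {V. openin Y V \<and> ?g V \<in> F}"
      using scott_open_filterD(4)[OF F, of "?g U" "?g V"] by auto
  next
    fix D assume D: "(\<forall>U\<in>D. openin Y U) \<and> directed_set D (\<subseteq>) \<and>
        \<Union>D \<in> {V. openin Y V \<and> ?g V \<in> F}"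
    have "?g (\<Union>D) = \<Union>(?g ` D)" by auto
    moreover have "directed_set (?g ` D) (\<subseteq>)"
      using D by (intro directed_set_image_mono[of D "(\<subseteq>)"]) auto
    ultimately have "\<exists>U\<in>?g ` D. U \<in> F"
      using D o by (intro scott_open_filterD(5)[OF F]) auto
    then show "\<exists>U\<in>D. U \<in> {V. openin Y V \<and> ?g V \<in> F}"
      using D by auto
  qed auto
qed

lemma PAV_map_apply:
  "openin Y V \<Longrightarrow> PAV_map X Y f \<alpha> V = \<alpha> {x \<in> topspace X. f x \<in> V}"
  by (simp add: PAV_map_def)

lemma A_valuation_PAV_map:
  assumes f: "continuous_map X Y f" and \<alpha>: "A_valuation X \<alpha>"
  shows "A_valuation Y (PAV_map X Y f \<alpha>)"
proof -
  let ?g = "\<lambda>V. {x \<in> topspace X. f x \<in> V}"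
  have o: "openin X (?g V)" if "openin Y V" for V
    using f that by (rule openin_continuous_map_preimage)
  from \<alpha> have F: "scott_open_filter X {U. openin X U \<and> \<alpha> U = A1}"
    and L: "linked X (\<lambda>U. \<alpha> U = A1) (\<lambda>U. \<alpha> U \<noteq> A0)"
    and "\<exists>C. closedin X C \<and> (\<forall>U. openin X U \<longrightarrow> (\<alpha> U \<noteq> A0 \<longleftrightarrow> C \<inter> U \<noteq> {}))"
    by (simp_all add: A_valuation_iff_linked)
  then obtain C where C: "closedin X C" "\<And>U. openin X U \<Longrightarrow> \<alpha> U \<noteq> A0 \<longleftrightarrow> C \<inter> U \<noteq> {}"
    by blast
  have sC: "C \<subseteq> topspace X" using C(1) by (rule closedin_subset)
  then have "f ` C \<subseteq> topspace Y"
    using f by (auto simp: continuous_map_def)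
  then have "(Y closure_of (f ` C)) \<inter> V \<noteq> {} \<longleftrightarrow> C \<inter> ?g V \<noteq> {}" if "openin Y V" for V
    using closure_of_meets_open_iff[of "f ` C" Y V] sC that by auto
  then have 1: "\<exists>C'. closedin Y C' \<and>
      (\<forall>V. openin Y V \<longrightarrow> (PAV_map X Y f \<alpha> V \<noteq> A0 \<longleftrightarrow> C' \<inter> V \<noteq> {}))"
    using C(2)[OF o] by (intro exI[of _ "Y closure_of (f ` C)"]) (simp add: PAV_map_apply)
  have "{V. openin Y V \<and> PAV_map X Y f \<alpha> V = A1}
      = {V. openin Y V \<and> ?g V \<in> {U. openin X U \<and> \<alpha> U = A1}}"
    using o by (auto simp: PAV_map_apply)
  then have 2: "scott_open_filter Y {V. openin Y V \<and> PAV_map X Y f \<alpha> V = A1}"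
    using scott_open_filter_vimage[OF F f] by simp
  have 3: "linked Y (\<lambda>V. PAV_map X Y f \<alpha> V = A1) (\<lambda>V. PAV_map X Y f \<alpha> V \<noteq> A0)"
    using linked_vimage[OF L f] by (simp add: PAV_map_apply cong: linked_cong)
  show ?thesis
    unfolding A_valuation_iff_linked using 1 2 3 by (simp add: PAV_map_def)
qed

section \<open>Functoriality and continuity\<close>

lemma quasi_lens_eqI:
  assumes "quasi_lens X L" "quasi_lens X L'"
    and "\<And>U. openin X U \<Longrightarrow> fst L \<subseteq> U \<longleftrightarrow> fst L' \<subseteq> U"
    and "\<And>U. openin X U \<Longrightarrow> snd L \<inter> U \<noteq> {} \<longleftrightarrow> snd L' \<inter> U \<noteq> {}"
  shows "L = L'"
proof (rule prod_eqI)
  have *: "saturatedin X (fst K)" "closedin X (snd K)" if "quasi_lens X K" for K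
    using that by (cases K; simp add: quasi_lens_iff_linked)+
  show "fst L = fst L'"
    using *(1)[OF assms(1)] *(1)[OF assms(2)] assms(3) by (rule saturatedin_eqI)
  show "snd L = snd L'"
    using *(2)[OF assms(1)] *(2)[OF assms(2)] assms(4) by (rule closedin_eqI)
qed

lemma PqV_map_comp:
  assumes f: "continuous_map X Y f" and g: "continuous_map Y Z g" and h: "continuous_map X Z h"
    and eq: "\<And>x. x \<in> topspace X \<Longrightarrow> g (f x) = h x" and L: "quasi_lens X L"
  shows "PqV_map Z g (PqV_map Y f L) = PqV_map Z h L"
proof (rule quasi_lens_eqI[of Z])
  have L': "quasi_lens Y (PqV_map Y f L)" using f L by (rule quasi_lens_PqV_map)
  show "quasi_lens Z (PqV_map Z g (PqV_map Y f L))" "quasi_lens Z (PqV_map Z h L)"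
    using quasi_lens_PqV_map g h L L' by blast+
  fix V assume V: "openin Z V"
  have o: "openin Y {y \<in> topspace Y. g y \<in> V}"
    using g V by (rule openin_continuous_map_preimage)
  have "{x \<in> topspace X. f x \<in> {y \<in> topspace Y. g y \<in> V}} = {x \<in> topspace X. h x \<in> V}"
    using eq f by (auto simp: continuous_map_def)
  then show "fst (PqV_map Z g (PqV_map Y f L)) \<subseteq> V \<longleftrightarrow> fst (PqV_map Z h L) \<subseteq> V"
    "snd (PqV_map Z g (PqV_map Y f L)) \<inter> V \<noteq> {} \<longleftrightarrow> snd (PqV_map Z h L) \<inter> V \<noteq> {}"
    using PqV_map_tests[OF g L' V] PqV_map_tests[OF f L o] PqV_map_tests[OF h L V] by simp_all
qed

lemma PAV_map_comp:
  assumes f: "continuous_map X Y f" and g: "continuous_map Y Z g"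
    and eq: "\<And>x. x \<in> topspace X \<Longrightarrow> g (f x) = h x"
  shows "PAV_map Y Z g (PAV_map X Y f \<alpha>) = PAV_map X Z h \<alpha>"
proof
  fix V
  have "{x \<in> topspace X. f x \<in> {y \<in> topspace Y. g y \<in> V}} = {x \<in> topspace X. h x \<in> V}"
    using eq f by (auto simp: continuous_map_def)
  then show "PAV_map Y Z g (PAV_map X Y f \<alpha>) V = PAV_map X Z h \<alpha> V"
    using openin_continuous_map_preimage[OF g, of V]
    by (cases "openin Z V") (simp_all add: PAV_map_apply, simp add: PAV_map_def)
qed

text \<open>Projections replace pattern matching here, so that membership in a subbasic set unfolds for a
quasi-lens that is not displayed as a pair.\<close>

definition PqV_subbase :: "'a topology \<Rightarrow> ('a set \<times> 'a set) set set" where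
  "PqV_subbase X = {{L. quasi_lens X L \<and> fst L \<subseteq> U} | U. openin X U} \<union>
      {{L. quasi_lens X L \<and> snd L \<inter> U \<noteq> {}} | U. openin X U}"

lemma PqV_eq_subbase: "PqV X = topology_generated_by (PqV_subbase X)"
  unfolding PqV_def PqV_subbase_def by (simp add: split_beta')

definition PAV_subbase :: "'a topology \<Rightarrow> ('a set \<Rightarrow> three) set set" where
  "PAV_subbase X = {{\<alpha>. A_valuation X \<alpha> \<and> \<alpha> U = A1} | U. openin X U} \<union>
      {{\<alpha>. A_valuation X \<alpha> \<and> \<alpha> U \<noteq> A0} | U. openin X U}"

lemma PAV_eq_subbase: "PAV X = topology_generated_by (PAV_subbase X)"
  unfolding PAV_def PAV_subbase_def ..

lemma openin_PqV:
  assumes "openin X U"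
  shows "openin (PqV X) {L. quasi_lens X L \<and> fst L \<subseteq> U}"
    "openin (PqV X) {L. quasi_lens X L \<and> snd L \<inter> U \<noteq> {}}"
  unfolding PqV_eq_subbase PqV_subbase_def
  using assms by (intro topology_generated_by_Basis; blast)+

lemma openin_PAV:
  assumes "openin X U"
  shows "openin (PAV X) {\<alpha>. A_valuation X \<alpha> \<and> \<alpha> U = A1}"
    "openin (PAV X) {\<alpha>. A_valuation X \<alpha> \<and> \<alpha> U \<noteq> A0}"
  unfolding PAV_eq_subbase PAV_subbase_def
  using assms by (intro topology_generated_by_Basis; blast)+

lemma vimage_Int_Collect: "f -` A \<inter> Collect P = {x. P x \<and> f x \<in> A}"
  by auto

lemma continuous_map_PqV_map:
  assumes f: "continuous_map X Y f"
  shows "continuous_map (PqV X) (PqV Y) (PqV_map Y f)"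
  unfolding PqV_eq_subbase[of Y]
proof (rule continuous_on_generated_topo)
  fix B assume "B \<in> PqV_subbase Y"
  then obtain V where V: "openin Y V"
    and "B = {L. quasi_lens Y L \<and> fst L \<subseteq> V} \<or> B = {L. quasi_lens Y L \<and> snd L \<inter> V \<noteq> {}}"
    unfolding PqV_subbase_def by blast
  moreover have "openin X {x \<in> topspace X. f x \<in> V}"
    using f V by (rule openin_continuous_map_preimage)
  note openin_PqV[OF this]
  moreover have
    "PqV_map Y f -` {L. quasi_lens Y L \<and> fst L \<subseteq> V} \<inter> topspace (PqV X)
      = {L. quasi_lens X L \<and> fst L \<subseteq> {x \<in> topspace X. f x \<in> V}}"
    "PqV_map Y f -` {L. quasi_lens Y L \<and> snd L \<inter> V \<noteq> {}} \<inter> topspace (PqV X)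
      = {L. quasi_lens X L \<and> snd L \<inter> {x \<in> topspace X. f x \<in> V} \<noteq> {}}"
    using PqV_map_tests[OF f _ V] quasi_lens_PqV_map[OF f]
    unfolding topspace_PqV vimage_Int_Collect mem_Collect_eq by (simp_all cong: conj_cong)
  ultimately show "openin (PqV X) (PqV_map Y f -` B \<inter> topspace (PqV X))"
    by auto
next
  show "PqV_map Y f ` topspace (PqV X) \<subseteq> \<Union>(PqV_subbase Y)"
    using quasi_lens_PqV_map[OF f]
    unfolding topology_generated_by_topspace[symmetric] PqV_eq_subbase[symmetric] topspace_PqV
    by auto
qed

lemma continuous_map_PAV_map:
  assumes f: "continuous_map X Y f"
  shows "continuous_map (PAV X) (PAV Y) (PAV_map X Y f)"
  unfolding PAV_eq_subbase[of Y]
proof (rule continuous_on_generated_topo)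
  fix B assume "B \<in> PAV_subbase Y"
  then obtain V where V: "openin Y V"
    and "B = {\<alpha>. A_valuation Y \<alpha> \<and> \<alpha> V = A1} \<or> B = {\<alpha>. A_valuation Y \<alpha> \<and> \<alpha> V \<noteq> A0}"
    unfolding PAV_subbase_def by blast
  moreover have "openin X {x \<in> topspace X. f x \<in> V}"
    using f V by (rule openin_continuous_map_preimage)
  note openin_PAV[OF this]
  moreover have
    "PAV_map X Y f -` {\<alpha>. A_valuation Y \<alpha> \<and> \<alpha> V = A1} \<inter> topspace (PAV X)
      = {\<alpha>. A_valuation X \<alpha> \<and> \<alpha> {x \<in> topspace X. f x \<in> V} = A1}"
    "PAV_map X Y f -` {\<alpha>. A_valuation Y \<alpha> \<and> \<alpha> V \<noteq> A0} \<inter> topspace (PAV X)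
      = {\<alpha>. A_valuation X \<alpha> \<and> \<alpha> {x \<in> topspace X. f x \<in> V} \<noteq> A0}"
    using PAV_map_apply[OF V, of X f] A_valuation_PAV_map[OF f] unfolding topspace_PAV
    by auto
  ultimately show "openin (PAV X) (PAV_map X Y f -` B \<inter> topspace (PAV X))"
    by auto
next
  show "PAV_map X Y f ` topspace (PAV X) \<subseteq> \<Union>(PAV_subbase Y)"
    using A_valuation_PAV_map[OF f]
    unfolding topology_generated_by_topspace[symmetric] PAV_eq_subbase[symmetric] topspace_PAV
    by auto
qed

section \<open>Recognising projective limits\<close>

text \<open>The first conditions on the \<open>q i\<close> make the comparison map a continuous bijection. Its inverse is
continuous as soon as every subbasic set \<open>b\<close> is a union of sets pulled back from a single factor,
which is what the last condition states pointwise.\<close>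

lemma is_projective_limitI:
  assumes gen: "Y = topology_generated_by B"
    and cont: "\<And>i. i \<in> I \<Longrightarrow> continuous_map Y (Z i) (q i)"
    and compat: "\<And>i j y. i \<in> I \<Longrightarrow> j \<in> I \<Longrightarrow> le i j \<Longrightarrow> y \<in> topspace Y \<Longrightarrow> r i j (q j y) = q i y"
    and inj: "\<And>y y'. y \<in> topspace Y \<Longrightarrow> y' \<in> topspace Y \<Longrightarrow> (\<And>i. i \<in> I \<Longrightarrow> q i y = q i y') \<Longrightarrow> y = y'"
    and surj: "\<And>z. (\<And>i. i \<in> I \<Longrightarrow> z i \<in> topspace (Z i)) \<Longrightarrow>
        (\<And>i j. i \<in> I \<Longrightarrow> j \<in> I \<Longrightarrow> le i j \<Longrightarrow> r i j (z j) = z i) \<Longrightarrow>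
        \<exists>y\<in>topspace Y. \<forall>i\<in>I. q i y = z i"
    and opn: "\<And>b y. b \<in> B \<Longrightarrow> y \<in> b \<Longrightarrow>
        \<exists>i\<in>I. \<exists>W. openin (Z i) W \<and> q i y \<in> W \<and> (\<forall>y'\<in>topspace Y. q i y' \<in> W \<longrightarrow> y' \<in> b)"
  shows "is_projective_limit I le Z r Y q"
proof -
  let ?L = "canonical_limit I le Z r"
  define h where "h = (\<lambda>y. \<lambda>i\<in>I. q i y)"
  define g where "g = inv_into (topspace Y) h"
  have topL: "topspace ?L = {x \<in> (\<Pi>\<^sub>E i\<in>I. topspace (Z i)). \<forall>i\<in>I. \<forall>j\<in>I. le i j \<longrightarrow> r i j (x j) = x i}"
    unfolding canonical_limit_def by auto
  have qi: "q i y \<in> topspace (Z i)" if "i \<in> I" "y \<in> topspace Y" for i y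
    using cont[OF that(1)] that(2) by (auto simp: continuous_map_def)
  have hL: "h y \<in> topspace ?L" if "y \<in> topspace Y" for y
    unfolding topL h_def using that qi compat by auto
  have h_cont: "continuous_map Y ?L h"
  proof -
    have "continuous_map Y (product_topology Z I) h"
      unfolding continuous_map_componentwise h_def using cont by auto
    then show ?thesis
      unfolding canonical_limit_def continuous_map_in_subtopology
      using hL topL by auto
  qed
  have h_inj: "inj_on h (topspace Y)"
  proof (rule inj_onI)
    fix y y' assume y: "y \<in> topspace Y" "y' \<in> topspace Y" and "h y = h y'"
    then have "q i y = q i y'" if "i \<in> I" for i
      using that by (metis h_def restrict_apply')
    then show "y = y'" using inj y by blast
  qed
  have h_surj: "topspace ?L \<subseteq> h ` topspace Y"
  proof
    fix z assume z: "z \<in> topspace ?L"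
    then have ext: "z \<in> extensional I" unfolding topL by (auto simp: PiE_def)
    obtain y where y: "y \<in> topspace Y" "\<forall>i\<in>I. q i y = z i"
      using surj[of z] z unfolding topL by auto
    then have "h y = z"
      unfolding h_def using ext by (auto simp: fun_eq_iff extensional_def)
    then show "z \<in> h ` topspace Y" using y by auto
  qed
  have gh: "g (h y) = y" if "y \<in> topspace Y" for y
    unfolding g_def using h_inj that by (rule inv_into_f_f)
  have hg: "h (g z) = z" "g z \<in> topspace Y" if "z \<in> topspace ?L" for z
    unfolding g_def using h_surj that by (auto intro: f_inv_into_f inv_into_into)
  have g_cont: "continuous_map ?L Y g"
    unfolding gen
  proof (rule continuous_on_generated_topo)
    show "g ` topspace ?L \<subseteq> \<Union>B"
      using hg(2) unfolding gen topology_generated_by_topspace by auto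
    fix b assume b: "b \<in> B"
    show "openin ?L (g -` b \<inter> topspace ?L)"
      unfolding openin_subopen[of ?L "g -` b \<inter> topspace ?L"]
    proof
      fix z assume z: "z \<in> g -` b \<inter> topspace ?L"
      obtain i W where iW: "i \<in> I" "openin (Z i) W" "q i (g z) \<in> W"
        "\<forall>y'\<in>topspace Y. q i y' \<in> W \<longrightarrow> y' \<in> b"
        using opn[OF b, of "g z"] z by auto
      have qg: "q i (g x) = x i" if "x \<in> topspace ?L" for x
        using hg(1)[OF that] iW(1) unfolding h_def by (metis restrict_apply')
      have "continuous_map ?L (Z i) (\<lambda>x. x i)"
        unfolding canonical_limit_def
        using continuous_map_product_projection[OF iW(1)] by (rule continuous_map_from_subtopology)
      then have "openin ?L {x \<in> topspace ?L. x i \<in> W}"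
        using iW(2) by (rule openin_continuous_map_preimage)
      moreover have "{x \<in> topspace ?L. x i \<in> W} \<subseteq> g -` b \<inter> topspace ?L"
        using iW(4) qg hg(2) by auto
      moreover have "z \<in> {x \<in> topspace ?L. x i \<in> W}"
        using z iW(3) qg by auto
      ultimately show "\<exists>T. openin ?L T \<and> z \<in> T \<and> T \<subseteq> g -` b \<inter> topspace ?L"
        by blast
    qed
  qed
  have "homeomorphic_maps Y ?L h g"
    unfolding homeomorphic_maps_def using h_cont g_cont gh hg by blast
  then show ?thesis
    unfolding is_projective_limit_def homeomorphic_map_maps h_def by blast
qed

section \<open>Points avoiding a compatible family of open sets\<close>

text \<open>An open set that is prime under intersection has an irreducible complement. The point found is
its generic point, and the equivalence expresses that its closure is the complement of \<open>M\<close>.\<close>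

lemma sober_space_avoiding_point:
  assumes sob: "sober_space X" and M: "openin X M" "M \<noteq> topspace X"
    and prime: "\<And>G G'. openin X G \<Longrightarrow> openin X G' \<Longrightarrow> \<not> G \<subseteq> M \<Longrightarrow> \<not> G' \<subseteq> M \<Longrightarrow> \<not> G \<inter> G' \<subseteq> M"
  shows "\<exists>x\<in>topspace X. \<forall>G. openin X G \<longrightarrow> (x \<in> G \<longleftrightarrow> \<not> G \<subseteq> M)"
proof -
  define C where "C = topspace X - M"
  have C: "closedin X C" unfolding C_def using M(1) by (intro closedin_diff) auto
  have meets: "C \<inter> G \<noteq> {} \<longleftrightarrow> \<not> G \<subseteq> M" if "openin X G" for G
    using openin_subset[OF that] unfolding C_def by auto
  have "C \<noteq> {}" using M openin_subset unfolding C_def by auto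
  moreover have "C \<subseteq> C1 \<or> C \<subseteq> C2" if "closedin X C1" "closedin X C2" "C \<subseteq> C1 \<union> C2" for C1 C2
  proof -
    have sub: "C \<subseteq> C' \<longleftrightarrow> topspace X - C' \<subseteq> M" for C'
      unfolding C_def using openin_subset[OF M(1)] by auto
    have o: "openin X (topspace X - C1)" "openin X (topspace X - C2)"
      using that by (auto intro: openin_diff)
    have "(topspace X - C1) \<inter> (topspace X - C2) \<subseteq> M"
      using that(3) unfolding C_def by auto
    then show ?thesis using prime[OF o] unfolding sub by auto
  qed
  ultimately have "irreducible_closedin X C"
    unfolding irreducible_closedin_def using C by simp
  then obtain x where x: "x \<in> topspace X" "C = X closure_of {x}"
    using sob unfolding sober_space_def by auto
  have "x \<in> G \<longleftrightarrow> \<not> G \<subseteq> M" if "openin X G" for G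
    using closure_of_meets_open_iff[of "{x}" X G] x meets[OF that] that by simp
  then show ?thesis using x(1) by auto
qed

locale proj_system =
  fixes I :: "'i set" and le :: "'i \<Rightarrow> 'i \<Rightarrow> bool"
    and Xs :: "'i \<Rightarrow> 'a topology" and p :: "'i \<Rightarrow> 'i \<Rightarrow> 'a \<Rightarrow> 'a"
  assumes system: "projective_system I le Xs p"
begin

text \<open>Three operations on open sets recur: \<open>pre i j\<close> is inverse image along the bonding map, \<open>cyl i\<close>
is inverse image along the projection from the limit, and \<open>under i\<close> is the right adjoint of
\<open>cyl i\<close>.\<close>

definition Lim :: "('i \<Rightarrow> 'a) topology" where
  "Lim = canonical_limit I le Xs p"

definition pre :: "'i \<Rightarrow> 'i \<Rightarrow> 'a set \<Rightarrow> 'a set" where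
  "pre i j V = {x \<in> topspace (Xs j). p i j x \<in> V}"

definition cyl :: "'i \<Rightarrow> 'a set \<Rightarrow> ('i \<Rightarrow> 'a) set" where
  "cyl i V = {x \<in> topspace Lim. x i \<in> V}"

definition under :: "'i \<Rightarrow> ('i \<Rightarrow> 'a) set \<Rightarrow> 'a set" where
  "under i U = \<Union>{V. openin (Xs i) V \<and> cyl i V \<subseteq> U}"

lemma le_refl: "i \<in> I \<Longrightarrow> le i i"
  using system unfolding projective_system_def reflp_on_def by simp

lemma transp_le: "transp_on I le"
  using system unfolding projective_system_def by simp

lemma le_trans: "i \<in> I \<Longrightarrow> j \<in> I \<Longrightarrow> k \<in> I \<Longrightarrow> le i j \<Longrightarrow> le j k \<Longrightarrow> le i k"
  using transp_onD[OF transp_le] .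

lemma directed: "directed_set I le"
  using system unfolding projective_system_def by simp

lemma upper_bound:
  assumes "i \<in> I" "j \<in> I"
  obtains k where "k \<in> I" "le i k" "le j k"
  using directed assms unfolding directed_set_def by auto

lemma continuous_bond: "i \<in> I \<Longrightarrow> j \<in> I \<Longrightarrow> le i j \<Longrightarrow> continuous_map (Xs j) (Xs i) (p i j)"
  using system unfolding projective_system_def by simp

lemma bond_comp:
  "i \<in> I \<Longrightarrow> j \<in> I \<Longrightarrow> k \<in> I \<Longrightarrow> le i j \<Longrightarrow> le j k \<Longrightarrow> x \<in> topspace (Xs k) \<Longrightarrow>
    p i j (p j k x) = p i k x"
  using system unfolding projective_system_def by simp

lemma bond_in: "i \<in> I \<Longrightarrow> j \<in> I \<Longrightarrow> le i j \<Longrightarrow> x \<in> topspace (Xs j) \<Longrightarrow> p i j x \<in> topspace (Xs i)"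
  using continuous_bond[of i j] by (auto simp: continuous_map_def)

lemma topspace_Lim:
  "topspace Lim = {x \<in> (\<Pi>\<^sub>E i\<in>I. topspace (Xs i)). \<forall>i\<in>I. \<forall>j\<in>I. le i j \<longrightarrow> p i j (x j) = x i}"
  unfolding Lim_def canonical_limit_def by auto

lemma Lim_coord: "x \<in> topspace Lim \<Longrightarrow> i \<in> I \<Longrightarrow> x i \<in> topspace (Xs i)"
  unfolding topspace_Lim by auto

lemma Lim_bond: "x \<in> topspace Lim \<Longrightarrow> i \<in> I \<Longrightarrow> j \<in> I \<Longrightarrow> le i j \<Longrightarrow> p i j (x j) = x i"
  unfolding topspace_Lim by simp

lemma continuous_proj: "i \<in> I \<Longrightarrow> continuous_map Lim (Xs i) (\<lambda>x. x i)"
  unfolding Lim_def canonical_limit_def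
  by (intro continuous_map_from_subtopology continuous_map_product_projection)

lemma openin_pre: "i \<in> I \<Longrightarrow> j \<in> I \<Longrightarrow> le i j \<Longrightarrow> openin (Xs i) V \<Longrightarrow> openin (Xs j) (pre i j V)"
  unfolding pre_def by (rule openin_continuous_map_preimage[OF continuous_bond])

lemma pre_mono: "V \<subseteq> W \<Longrightarrow> pre i j V \<subseteq> pre i j W"
  unfolding pre_def by auto

lemma pre_Un: "pre i j (V \<union> W) = pre i j V \<union> pre i j W"
  unfolding pre_def by auto

lemma pre_pre:
  "i \<in> I \<Longrightarrow> j \<in> I \<Longrightarrow> k \<in> I \<Longrightarrow> le i j \<Longrightarrow> le j k \<Longrightarrow> pre j k (pre i j V) = pre i k V"
  unfolding pre_def using bond_comp[of i j k] bond_in[of j k] by auto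

lemma openin_cyl: "i \<in> I \<Longrightarrow> openin (Xs i) V \<Longrightarrow> openin Lim (cyl i V)"
  unfolding cyl_def by (rule openin_continuous_map_preimage[OF continuous_proj])

lemma cyl_mono: "V \<subseteq> W \<Longrightarrow> cyl i V \<subseteq> cyl i W"
  unfolding cyl_def by auto

lemma cyl_Un: "cyl i (V \<union> W) = cyl i V \<union> cyl i W"
  unfolding cyl_def by auto

lemma cyl_Int: "cyl i (V \<inter> W) = cyl i V \<inter> cyl i W"
  unfolding cyl_def by auto

lemma cyl_pre: "i \<in> I \<Longrightarrow> j \<in> I \<Longrightarrow> le i j \<Longrightarrow> cyl j (pre i j V) = cyl i V"
  unfolding cyl_def pre_def using Lim_coord Lim_bond by auto

lemma openin_under: "openin (Xs i) (under i U)"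
  unfolding under_def by (rule openin_Union) simp

lemma cyl_under_subset: "cyl i (under i U) \<subseteq> U"
  unfolding cyl_def under_def by auto

lemma subset_underI: "openin (Xs i) V \<Longrightarrow> cyl i V \<subseteq> U \<Longrightarrow> V \<subseteq> under i U"
  unfolding under_def by auto

lemma pre_under: "i \<in> I \<Longrightarrow> j \<in> I \<Longrightarrow> le i j \<Longrightarrow> pre i j (under i U) \<subseteq> under j U"
  using cyl_under_subset[of i U] by (intro subset_underI openin_pre openin_under) (simp_all add: cyl_pre)

lemma cyl_under_mono: "i \<in> I \<Longrightarrow> j \<in> I \<Longrightarrow> le i j \<Longrightarrow> cyl i (under i U) \<subseteq> cyl j (under j U)"
  using cyl_mono[OF pre_under, of i j j U] by (simp add: cyl_pre)

text \<open>A basic open box of the product restricts finitely many coordinates; an upper bound \<open>k\<close> of their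
indices turns the box, within the limit, into a cylinder over the single coordinate \<open>k\<close>.\<close>

lemma open_eq_Union_cyl_under:
  assumes U: "openin Lim U"
  shows "U = (\<Union>i\<in>I. cyl i (under i U))"
proof
  show "U \<subseteq> (\<Union>i\<in>I. cyl i (under i U))"
  proof
    fix x assume x: "x \<in> U"
    have xL: "x \<in> topspace Lim" using openin_subset[OF U] x by auto
    obtain T where T: "openin (product_topology Xs I) T"
      "U = T \<inter> {x \<in> (\<Pi>\<^sub>E i\<in>I. topspace (Xs i)). \<forall>i\<in>I. \<forall>j\<in>I. le i j \<longrightarrow> p i j (x j) = x i}"
      using U unfolding Lim_def canonical_limit_def openin_subtopology by auto
    then obtain W where W: "finite {i \<in> I. W i \<noteq> topspace (Xs i)}" "\<forall>i\<in>I. openin (Xs i) (W i)"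
      "x \<in> Pi\<^sub>E I W" "Pi\<^sub>E I W \<subseteq> T"
      using x unfolding openin_product_topology_alt by auto
    \<comment> \<open>The coordinates that the box really restricts.\<close>
    define J where "J = {i \<in> I. W i \<noteq> topspace (Xs i)}"
    have J: "finite J" "J \<subseteq> I" using W(1) unfolding J_def by auto
    obtain k where k: "k \<in> I" "\<forall>j\<in>J. le j k"
      using directed_set_finite_upper_bound[OF directed transp_le J] by auto
    define V where "V = topspace (Xs k) \<inter> (\<Inter>j\<in>J. pre j k (W j))"
    have "openin (Xs k) V"
    proof (cases "J = {}")
      case False
      then show ?thesis unfolding V_def using J k W(2)
        by (intro openin_Int openin_INT2 openin_pre) auto
    qed (simp add: V_def)
    moreover have "cyl k V \<subseteq> U"
    proof
      fix y assume y: "y \<in> cyl k V"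
      then have yL: "y \<in> topspace Lim" by (simp add: cyl_def)
      have "y i \<in> W i" if i: "i \<in> I" for i
      proof (cases "i \<in> J")
        case True
        then have "p i k (y k) \<in> W i" using y unfolding cyl_def V_def pre_def by auto
        then show ?thesis using Lim_bond[OF yL i k(1)] k(2) True by simp
      next
        case False
        then show ?thesis using i Lim_coord[OF yL i] unfolding J_def by auto
      qed
      moreover have "y \<in> extensional I" using yL unfolding topspace_Lim PiE_def by auto
      ultimately have "y \<in> Pi\<^sub>E I W" by (auto simp: PiE_def)
      then show "y \<in> U" using W(4) T(2) yL unfolding topspace_Lim by auto
    qed
    ultimately have "V \<subseteq> under k U" by (rule subset_underI)
    moreover have "p j k (x k) \<in> W j" if "j \<in> J" for j
      using Lim_bond[OF xL _ k(1), of j] J(2) k(2) W(3) that by (auto simp: PiE_def Pi_def)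
    then have "x k \<in> V"
      unfolding V_def pre_def using Lim_coord[OF xL k(1)] by auto
    ultimately have "x \<in> cyl k (under k U)" using xL unfolding cyl_def by auto
    then show "x \<in> (\<Union>i\<in>I. cyl i (under i U))" using k(1) by auto
  qed
  show "(\<Union>i\<in>I. cyl i (under i U)) \<subseteq> U" using cyl_under_subset by auto
qed

lemma compactin_subset_iff_under:
  assumes Q: "compactin Lim Q" and U: "openin Lim U"
  shows "Q \<subseteq> U \<longleftrightarrow> (\<exists>i\<in>I. Q \<subseteq> cyl i (under i U))"
proof
  assume "Q \<subseteq> U"
  then have "Q \<subseteq> \<Union>((\<lambda>i. cyl i (under i U)) ` I)"
    using open_eq_Union_cyl_under[OF U] by simp
  then have "\<exists>W\<in>(\<lambda>i. cyl i (under i U)) ` I. Q \<subseteq> W"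
    using directed_set_image_mono[OF directed cyl_under_mono] openin_cyl openin_under
    by (intro compactin_directedD[OF Q]) auto
  then show "\<exists>i\<in>I. Q \<subseteq> cyl i (under i U)" by auto
next
  assume "\<exists>i\<in>I. Q \<subseteq> cyl i (under i U)"
  then show "Q \<subseteq> U" using cyl_under_subset by blast
qed

lemma meets_iff_under:
  assumes U: "openin Lim U"
  shows "C \<inter> U \<noteq> {} \<longleftrightarrow> (\<exists>i\<in>I. C \<inter> cyl i (under i U) \<noteq> {})"
  by (subst open_eq_Union_cyl_under[OF U]) auto

lemma A_valuation_iff_under:
  assumes \<alpha>: "A_valuation Lim \<alpha>" and U: "openin Lim U"
  shows "\<alpha> U = A1 \<longleftrightarrow> (\<exists>i\<in>I. \<alpha> (cyl i (under i U)) = A1)"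
    and "\<alpha> U \<noteq> A0 \<longleftrightarrow> (\<exists>i\<in>I. \<alpha> (cyl i (under i U)) \<noteq> A0)"
proof -
  let ?D = "(\<lambda>i. cyl i (under i U)) ` I"
  have "directed_set ?D (\<subseteq>)"
    by (rule directed_set_image_mono[OF directed cyl_under_mono])
  moreover have "\<forall>V\<in>?D. openin Lim V"
    using openin_cyl openin_under by auto
  ultimately have "\<alpha> (\<Union>?D) = (SUP V\<in>?D. \<alpha> V)"
    using \<alpha> unfolding A_valuation_def scott_continuous_opens_def by simp
  then have *: "\<alpha> U = (SUP V\<in>?D. \<alpha> V)"
    using open_eq_Union_cyl_under[OF U] by simp
  show "\<alpha> U = A1 \<longleftrightarrow> (\<exists>i\<in>I. \<alpha> (cyl i (under i U)) = A1)"
    unfolding * Sup_three_eq_A1_iff by force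
  show "\<alpha> U \<noteq> A0 \<longleftrightarrow> (\<exists>i\<in>I. \<alpha> (cyl i (under i U)) \<noteq> A0)"
    unfolding * Sup_three_neq_A0_iff by simp
qed

text \<open>In terms of complements, these are families of closed sets that the bonding maps carry into one
another.\<close>

definition compatible_opens :: "('i \<Rightarrow> 'a set) \<Rightarrow> bool" where
  "compatible_opens W \<longleftrightarrow> (\<forall>i\<in>I. openin (Xs i) (W i)) \<and>
     (\<forall>i\<in>I. \<forall>j\<in>I. le i j \<longrightarrow> pre i j (W i) \<subseteq> W j)"

end

text \<open>A point of the projective limit of the Scott-open filter functor.\<close>

locale filtered_proj_system = proj_system I le Xs p
  for I :: "'i set" and le :: "'i \<Rightarrow> 'i \<Rightarrow> bool"
    and Xs :: "'i \<Rightarrow> 'a topology" and p :: "'i \<Rightarrow> 'i \<Rightarrow> 'a \<Rightarrow> 'a" +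
  fixes F :: "'i \<Rightarrow> 'a set set"
  assumes sober: "\<And>i. i \<in> I \<Longrightarrow> sober_space (Xs i)"
    and filter: "\<And>i. i \<in> I \<Longrightarrow> scott_open_filter (Xs i) (F i)"
    and pre_filter: "\<And>i j V. i \<in> I \<Longrightarrow> j \<in> I \<Longrightarrow> le i j \<Longrightarrow> openin (Xs i) V \<Longrightarrow>
        pre i j V \<in> F j \<longleftrightarrow> V \<in> F i"
begin

lemma filter_up: "i \<in> I \<Longrightarrow> U \<in> F i \<Longrightarrow> openin (Xs i) V \<Longrightarrow> U \<subseteq> V \<Longrightarrow> V \<in> F i"
  using scott_open_filterD(3)[OF filter] .

text \<open>Among the compatible families above \<open>W\<close> that contain \<open>G\<close> at index \<open>i\<close> there is a natural
candidate: put into \<open>W' j\<close> every open set that lies in \<open>W k \<union> pre i k G\<close> when seen from some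
later stage \<open>k\<close>. The stages are directed, so \<open>W' j\<close> is a directed union and avoids the Scott-open
filter \<open>F j\<close> because each of its members does. For a maximal avoiding
family \<open>W\<close> that does not contain \<open>G\<close>, it follows that \<open>W k \<union> pre i k G\<close> enters \<open>F k\<close> at some
later stage \<open>k\<close>.\<close>

lemma avoiding_extend:
  assumes W: "compatible_opens W" and i: "i \<in> I" and G: "openin (Xs i) G"
    and avoid: "\<And>k. k \<in> I \<Longrightarrow> le i k \<Longrightarrow> W k \<union> pre i k G \<notin> F k"
  shows "\<exists>W'. compatible_opens W' \<and> (\<forall>j\<in>I. W' j \<notin> F j \<and> W j \<subseteq> W' j) \<and> G \<subseteq> W' i"
proof -
  \<comment> \<open>The sets that lie in \<open>W k \<union> pre i k G\<close> when seen from a later stage \<open>k\<close>.\<close>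
  define D where "D = (\<lambda>j. {V. openin (Xs j) V \<and>
      (\<exists>k\<in>I. le i k \<and> le j k \<and> pre j k V \<subseteq> W k \<union> pre i k G)})"
  define W' where "W' = (\<lambda>j. \<Union>(D j))"
  have Wo: "openin (Xs j) (W j)" if "j \<in> I" for j
    using W that unfolding compatible_opens_def by simp
  have Wpre: "pre j k (W j) \<subseteq> W k" if "j \<in> I" "k \<in> I" "le j k" for j k
    using W that unfolding compatible_opens_def by simp
  have later: "pre j m V \<subseteq> W m \<union> pre i m G"
    if "j \<in> I" "k \<in> I" "m \<in> I" "le i k" "le j k" "le k m" "pre j k V \<subseteq> W k \<union> pre i k G" for j k m V
  proof -
    have "pre j m V = pre k m (pre j k V)" using that by (simp add: pre_pre)
    also have "\<dots> \<subseteq> pre k m (W k \<union> pre i k G)" using that by (intro pre_mono)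
    also have "\<dots> = pre k m (W k) \<union> pre i m G" using that i by (simp add: pre_Un pre_pre)
    also have "\<dots> \<subseteq> W m \<union> pre i m G" using Wpre[of k m] that by auto
    finally show ?thesis .
  qed
  have WD: "W j \<in> D j" if j: "j \<in> I" for j
  proof -
    obtain k where "k \<in> I" "le i k" "le j k" using upper_bound[OF i j] .
    then show ?thesis using Wo[OF j] Wpre[OF j, of k] unfolding D_def by auto
  qed
  have GD: "G \<in> D i"
    using G i le_refl[OF i] unfolding D_def by auto
  have dir: "directed_set (D j) (\<subseteq>)" if j: "j \<in> I" for j
    unfolding directed_set_def
  proof (intro conjI ballI)
    show "D j \<noteq> {}" using WD[OF j] by auto
    fix V V' assume "V \<in> D j" "V' \<in> D j"
    then obtain k k' where V: "openin (Xs j) V" "k \<in> I" "le i k" "le j k" "pre j k V \<subseteq> W k \<union> pre i k G"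
      and V': "openin (Xs j) V'" "k' \<in> I" "le i k'" "le j k'" "pre j k' V' \<subseteq> W k' \<union> pre i k' G"
      unfolding D_def by auto
    obtain m where m: "m \<in> I" "le k m" "le k' m" using upper_bound[OF V(2) V'(2)] .
    have "pre j m (V \<union> V') \<subseteq> W m \<union> pre i m G"
      unfolding pre_Un using later[OF j V(2) m(1) V(3,4) m(2) V(5)]
        later[OF j V'(2) m(1) V'(3,4) m(3) V'(5)] by simp
    moreover have "le i m" "le j m"
      using le_trans[OF i V(2) m(1)] le_trans[OF j V(2) m(1)] V m by auto
    ultimately have "V \<union> V' \<in> D j" using V(1) V'(1) m(1) unfolding D_def by auto
    then show "\<exists>U\<in>D j. V \<subseteq> U \<and> V' \<subseteq> U" by blast
  qed
  have "W' j \<notin> F j" if j: "j \<in> I" for j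
  proof
    assume "W' j \<in> F j"
    then have "\<exists>V\<in>D j. V \<in> F j"
      using scott_open_filterD(5)[OF filter[OF j] _ dir[OF j]] unfolding W'_def D_def by auto
    then obtain V k where V: "V \<in> F j" "openin (Xs j) V" and k: "k \<in> I" "le i k" "le j k"
      "pre j k V \<subseteq> W k \<union> pre i k G"
      unfolding D_def by auto
    have "pre j k V \<in> F k" using pre_filter[OF j k(1,3) V(2)] V(1) by simp
    then have "W k \<union> pre i k G \<in> F k"
      using k i G Wo by (intro filter_up[OF _ _ _ k(4)]) (auto intro: openin_pre)
    then show False using avoid k by simp
  qed
  moreover have "compatible_opens W'"
    unfolding compatible_opens_def
  proof (intro conjI ballI impI)
    fix j assume "j \<in> I"
    show "openin (Xs j) (W' j)" unfolding W'_def D_def by (rule openin_Union) auto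
  next
    fix j l assume jl: "j \<in> I" "l \<in> I" "le j l"
    show "pre j l (W' j) \<subseteq> W' l"
    proof
      fix x assume "x \<in> pre j l (W' j)"
      then obtain V k where V: "openin (Xs j) V" "x \<in> pre j l V" and k: "k \<in> I" "le i k" "le j k"
        "pre j k V \<subseteq> W k \<union> pre i k G"
        unfolding W'_def D_def pre_def by auto
      obtain m where m: "m \<in> I" "le k m" "le l m" using upper_bound[OF k(1) jl(2)] .
      have "pre l m (pre j l V) \<subseteq> W m \<union> pre i m G"
        using later[OF jl(1) k(1) m(1) k(2,3) m(2) k(4)] jl m by (simp add: pre_pre)
      moreover have "le i m" using le_trans[OF i k(1) m(1) k(2) m(2)] .
      ultimately have "pre j l V \<in> D l"
        using openin_pre[OF jl V(1)] m unfolding D_def by auto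
      then show "x \<in> W' l" using V(2) unfolding W'_def by auto
    qed
  qed
  moreover have "W j \<subseteq> W' j" if "j \<in> I" for j
    using WD[OF that] unfolding W'_def by auto
  moreover have "G \<subseteq> W' i" using GD unfolding W'_def by auto
  ultimately show ?thesis by (intro exI[of _ W']) simp
qed

text \<open>A family of sets indexed by \<open>I\<close> is encoded as a subset of \<open>I \<times> UNIV\<close>, so that Zorn's lemma for
inclusion applies. Unions of chains still avoid the filters because these are Scott-open.\<close>

lemma avoiding_maximal:
  assumes W: "compatible_opens W" "\<And>i. i \<in> I \<Longrightarrow> W i \<notin> F i"
  shows "\<exists>M. compatible_opens M \<and> (\<forall>i\<in>I. M i \<notin> F i \<and> W i \<subseteq> M i) \<and>
    (\<forall>M'. compatible_opens M' \<and> (\<forall>i\<in>I. M' i \<notin> F i \<and> M i \<subseteq> M' i) \<longrightarrow> (\<forall>i\<in>I. M' i \<subseteq> M i))"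
proof -
  define \<A> where "\<A> = {A. A \<subseteq> I \<times> UNIV \<and> compatible_opens (\<lambda>i. A `` {i}) \<and>
      (\<forall>i\<in>I. A `` {i} \<notin> F i \<and> W i \<subseteq> A `` {i})}"
  have Sig: "Sigma I V `` {i} = V i" if "i \<in> I" for V :: "'i \<Rightarrow> 'a set" and i :: 'i
    using that by auto
  have Sig_comp: "compatible_opens (\<lambda>i. Sigma I V `` {i}) \<longleftrightarrow> compatible_opens V" for V
    unfolding compatible_opens_def by (simp add: Sig cong: ball_cong)
  have "Sigma I W \<in> \<A>"
    unfolding \<A>_def using W by (auto simp add: Sig Sig_comp simp del: Image_singleton_iff)
  moreover have "\<Union>\<C> \<in> \<A>" if ne: "\<C> \<noteq> {}" and chain: "subset.chain \<A> \<C>" for \<C>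
  proof -
    have sub: "\<C> \<subseteq> \<A>" using chain by (auto simp: subset_chain_def)
    have lin: "A \<subseteq> B \<or> B \<subseteq> A" if "A \<in> \<C>" "B \<in> \<C>" for A B
      using chain that by (auto simp: subset_chain_def)
    have im: "\<Union>\<C> `` {i} = \<Union>((\<lambda>A. A `` {i}) ` \<C>)" for i by auto
    have o: "openin (Xs i) (A `` {i})" if "A \<in> \<C>" "i \<in> I" for A i
      using sub that unfolding \<A>_def compatible_opens_def by auto
    have "compatible_opens (\<lambda>i. \<Union>\<C> `` {i})"
      unfolding compatible_opens_def
    proof (intro conjI ballI impI)
      fix i assume "i \<in> I"
      then show "openin (Xs i) (\<Union>\<C> `` {i})" unfolding im using o by (intro openin_Union) auto
    next
      fix i j assume ij: "i \<in> I" "j \<in> I" "le i j"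
      have "pre i j (A `` {i}) \<subseteq> A `` {j}" if "A \<in> \<C>" for A
        using sub that ij unfolding \<A>_def compatible_opens_def by auto
      then show "pre i j (\<Union>\<C> `` {i}) \<subseteq> \<Union>\<C> `` {j}"
        unfolding pre_def by blast
    qed
    moreover have "\<Union>\<C> `` {i} \<notin> F i" if i: "i \<in> I" for i
    proof
      assume "\<Union>\<C> `` {i} \<in> F i"
      moreover have "directed_set ((\<lambda>A. A `` {i}) ` \<C>) (\<subseteq>)"
      proof (rule directed_set_image_mono)
        show "directed_set \<C> (\<subseteq>)"
          unfolding directed_set_def
        proof (intro conjI ballI ne)
          fix A B assume "A \<in> \<C>" "B \<in> \<C>"
          then show "\<exists>C\<in>\<C>. A \<subseteq> C \<and> B \<subseteq> C" using lin[of A B] by auto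
        qed
      qed auto
      ultimately have "\<exists>V\<in>(\<lambda>A. A `` {i}) ` \<C>. V \<in> F i"
        using o i unfolding im by (intro scott_open_filterD(5)[OF filter[OF i]]) auto
      then show False using sub i unfolding \<A>_def by auto
    qed
    moreover have "W i \<subseteq> \<Union>\<C> `` {i}" if "i \<in> I" for i
    proof -
      obtain A where "A \<in> \<C>" using ne by auto
      then have "W i \<subseteq> A `` {i}" using sub that unfolding \<A>_def by auto
      then show ?thesis using \<open>A \<in> \<C>\<close> by auto
    qed
    moreover have "\<Union>\<C> \<subseteq> I \<times> UNIV" using sub unfolding \<A>_def by auto
    ultimately show ?thesis unfolding \<A>_def by simp
  qed
  ultimately have "\<exists>A\<in>\<A>. \<forall>B\<in>\<A>. A \<subseteq> B \<longrightarrow> B = A"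
    by (intro subset_Zorn_nonempty) blast+
  then obtain A where A: "A \<in> \<A>" "\<And>B. B \<in> \<A> \<Longrightarrow> A \<subseteq> B \<Longrightarrow> B = A"
    by auto
  show ?thesis
  proof (intro exI[of _ "\<lambda>i. A `` {i}"] conjI allI impI)
    show "compatible_opens (\<lambda>i. A `` {i})" "\<forall>i\<in>I. A `` {i} \<notin> F i \<and> W i \<subseteq> A `` {i}"
      using A(1) unfolding \<A>_def by simp_all
    fix M' assume M': "compatible_opens M' \<and> (\<forall>i\<in>I. M' i \<notin> F i \<and> A `` {i} \<subseteq> M' i)"
    have "W i \<subseteq> M' i" if "i \<in> I" for i
      using A(1) M' that unfolding \<A>_def by blast
    then have "Sigma I M' \<in> \<A>"
      unfolding \<A>_def using M' by (auto simp add: Sig Sig_comp simp del: Image_singleton_iff)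
    moreover have "A \<subseteq> Sigma I M'"
      using M' A(1) unfolding \<A>_def by auto
    ultimately have "Sigma I M' = A" by (rule A(2))
    then show "\<forall>i\<in>I. M' i \<subseteq> A `` {i}" by auto
  qed
qed

text \<open>For a maximal avoiding family \<open>M\<close>, an open \<open>G\<close> lies in \<open>M i\<close> unless \<open>M k \<union> pre i k G \<in> F k\<close> at
some later stage \<open>k\<close>. Since filters are closed under intersection, this makes \<open>M i\<close> prime.
The criterion holds for \<open>G\<close> at \<open>i\<close> exactly if it holds for \<open>pre i j G\<close> at \<open>j\<close>, so the generic
points of the complements have the same open neighbourhoods as the images of one another and
form a point of the limit by \<open>T\<^sub>0\<close> separation.\<close>

lemma avoiding_point:
  assumes W: "compatible_opens W" "\<And>i. i \<in> I \<Longrightarrow> W i \<notin> F i"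
  shows "\<exists>x\<in>topspace Lim. \<forall>i\<in>I. x i \<notin> W i \<and> (\<forall>V\<in>F i. x i \<in> V)"
proof -
  obtain M where M: "compatible_opens M" and MF: "\<And>i. i \<in> I \<Longrightarrow> M i \<notin> F i"
    and WM: "\<And>i. i \<in> I \<Longrightarrow> W i \<subseteq> M i"
    and max: "\<And>M'. compatible_opens M' \<Longrightarrow> \<forall>i\<in>I. M' i \<notin> F i \<and> M i \<subseteq> M' i \<Longrightarrow> \<forall>i\<in>I. M' i \<subseteq> M i"
    using avoiding_maximal[OF W] by auto
  have Mo: "openin (Xs i) (M i)" if "i \<in> I" for i
    using M that unfolding compatible_opens_def by simp
  have Mpre: "pre i j (M i) \<subseteq> M j" if "i \<in> I" "j \<in> I" "le i j" for i j
    using M that unfolding compatible_opens_def by simp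
  have key: "\<exists>k\<in>I. le i k \<and> M k \<union> pre i k G \<in> F k"
    if i: "i \<in> I" and G: "openin (Xs i) G" "\<not> G \<subseteq> M i" for i G
  proof (rule ccontr)
    assume "\<not> ?thesis"
    then obtain M' where "compatible_opens M'" "\<forall>j\<in>I. M' j \<notin> F j \<and> M j \<subseteq> M' j" "G \<subseteq> M' i"
      using avoiding_extend[OF M i G(1)] by auto
    then have "G \<subseteq> M i" using max[of M'] i by (meson subset_trans)
    then show False using G(2) by contradiction
  qed
  have later: "M m \<union> pre i m G \<in> F m"
    if "i \<in> I" "k \<in> I" "m \<in> I" "le i k" "le k m" "openin (Xs i) G" "M k \<union> pre i k G \<in> F k" for i k m G
  proof -
    have o: "openin (Xs k) (M k \<union> pre i k G)"
      using that Mo openin_pre by auto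
    have "le i m" using le_trans that by metis
    then have "openin (Xs m) (M m \<union> pre i m G)"
      using that Mo openin_pre by auto
    moreover have "pre k m (M k \<union> pre i k G) \<in> F m"
      using pre_filter[OF that(2,3,5) o] that(7) by simp
    moreover have "pre k m (M k \<union> pre i k G) \<subseteq> M m \<union> pre i m G"
      using Mpre[OF that(2,3,5)] that by (simp add: pre_Un pre_pre) auto
    ultimately show ?thesis using filter_up that(3) by metis
  qed
  have "\<exists>x\<in>topspace (Xs i). \<forall>G. openin (Xs i) G \<longrightarrow> (x \<in> G \<longleftrightarrow> \<not> G \<subseteq> M i)" if i: "i \<in> I" for i
  proof (rule sober_space_avoiding_point[OF sober[OF i] Mo[OF i]])
    show "M i \<noteq> topspace (Xs i)"
      using MF[OF i] scott_open_filterD(2)[OF filter[OF i]] by auto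
    fix G G' assume G: "openin (Xs i) G" "openin (Xs i) G'" "\<not> G \<subseteq> M i" "\<not> G' \<subseteq> M i"
    obtain k where k: "k \<in> I" "le i k" "M k \<union> pre i k G \<in> F k" using key[OF i G(1,3)] by auto
    obtain l where l: "l \<in> I" "le i l" "M l \<union> pre i l G' \<in> F l" using key[OF i G(2,4)] by auto
    obtain m where m: "m \<in> I" "le k m" "le l m" using upper_bound[OF k(1) l(1)] .
    have im: "le i m" using le_trans[OF i k(1) m(1) k(2) m(2)] .
    \<comment> \<open>If \<open>G \<inter> G'\<close> were below \<open>M i\<close>, this member of \<open>F m\<close> would be \<open>M m\<close> itself.\<close>
    have "(M m \<union> pre i m G) \<inter> (M m \<union> pre i m G') \<in> F m"
      using scott_open_filterD(4)[OF filter[OF m(1)]]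
        later[OF i k(1) m(1) k(2) m(2) G(1) k(3)] later[OF i l(1) m(1) l(2) m(3) G(2) l(3)] by simp
    moreover have "(M m \<union> pre i m G) \<inter> (M m \<union> pre i m G') = M m \<union> pre i m (G \<inter> G')"
      unfolding pre_def by auto
    moreover have "M m \<union> pre i m (G \<inter> G') = M m" if "G \<inter> G' \<subseteq> M i"
      using pre_mono[OF that, of i m] Mpre[OF i m(1) im] by auto
    ultimately show "\<not> G \<inter> G' \<subseteq> M i" using MF[OF m(1)] by auto
  qed
  then obtain y where y: "\<And>i. i \<in> I \<Longrightarrow> y i \<in> topspace (Xs i)"
    "\<And>i G. i \<in> I \<Longrightarrow> openin (Xs i) G \<Longrightarrow> y i \<in> G \<longleftrightarrow> \<not> G \<subseteq> M i"
    by metis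
  have bond: "p i j (y j) = y i" if ij: "i \<in> I" "j \<in> I" "le i j" for i j
  proof (rule ccontr)
    assume "p i j (y j) \<noteq> y i"
    then obtain G where G: "openin (Xs i) G" "p i j (y j) \<notin> G \<longleftrightarrow> y i \<in> G"
      using sober[OF ij(1)] bond_in[OF ij y(1)[OF ij(2)]] y(1)[OF ij(1)]
      unfolding sober_space_def t0_space_def by metis
    have "p i j (y j) \<in> G \<longleftrightarrow> y j \<in> pre i j G"
      using y(1)[OF ij(2)] by (simp add: pre_def)
    also have "\<dots> \<longleftrightarrow> \<not> pre i j G \<subseteq> M j"
      using y(2)[OF ij(2)] openin_pre[OF ij G(1)] by simp
    also have "\<dots> \<longleftrightarrow> \<not> G \<subseteq> M i"
    proof
      assume "\<not> pre i j G \<subseteq> M j"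
      then show "\<not> G \<subseteq> M i" using pre_mono[of G "M i" i j] Mpre[OF ij] by auto
    next
      assume "\<not> G \<subseteq> M i"
      then obtain k where k: "k \<in> I" "le i k" "M k \<union> pre i k G \<in> F k" using key[OF ij(1) G(1)] by auto
      obtain m where m: "m \<in> I" "le k m" "le j m" using upper_bound[OF k(1) ij(2)] .
      have mF: "M m \<union> pre i m G \<in> F m"
        using later[OF ij(1) k(1) m(1) k(2) m(2) G(1) k(3)] .
      show "\<not> pre i j G \<subseteq> M j"
      proof
        assume "pre i j G \<subseteq> M j"
        then have "pre i m G \<subseteq> M m"
          using pre_mono[of "pre i j G" "M j" j m] Mpre[OF ij(2) m(1,3)] pre_pre[OF ij(1,2) m(1) ij(3) m(3)]
          by auto
        then show False using mF MF[OF m(1)] by (simp add: Un_absorb2)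
      qed
    qed
    also have "\<dots> \<longleftrightarrow> y i \<in> G" using y(2)[OF ij(1) G(1)] by simp
    finally show False using G(2) by simp
  qed
  have "restrict y I \<in> topspace Lim"
    unfolding topspace_Lim using y(1) bond by auto
  moreover have "y i \<notin> W i" if "i \<in> I" for i
    using y(2)[OF that Mo[OF that]] WM[OF that] by auto
  moreover have "y i \<in> V" if "i \<in> I" "V \<in> F i" for i V
  proof (rule ccontr)
    have o: "openin (Xs i) V" using scott_open_filterD(1)[OF filter[OF that(1)] that(2)] .
    assume "y i \<notin> V"
    then have "V \<subseteq> M i" using y(2)[OF that(1) o] by simp
    then have "M i \<in> F i" using filter_up[OF that Mo[OF that(1)]] by simp
    then show False using MF that(1) by simp
  qed
  ultimately show ?thesis by (intro bexI[of _ "restrict y I"]) auto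
qed

section \<open>The compact saturated set of a compatible family of Scott-open filters\<close>

definition kernel :: "('i \<Rightarrow> 'a) set" where
  "kernel = {x \<in> topspace Lim. \<forall>i\<in>I. \<forall>V\<in>F i. x i \<in> V}"

text \<open>If \<open>V \<notin> F i\<close>, then the open sets that fall into the preimage of \<open>V\<close> at some later stage
make up a compatible family that avoids the filters and contains \<open>V\<close> at \<open>i\<close>, so \<open>avoiding_point\<close> gives a point of the kernel outside the cylinder over \<open>V\<close>.\<close>

lemma kernel_subset_cyl_iff:
  assumes i: "i \<in> I" and V: "openin (Xs i) V"
  shows "kernel \<subseteq> cyl i V \<longleftrightarrow> V \<in> F i"
proof
  assume sub: "kernel \<subseteq> cyl i V"
  show "V \<in> F i"
  proof (rule ccontr)
    assume "V \<notin> F i"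
    then have "{} \<union> pre i k V \<notin> F k" if "k \<in> I" "le i k" for k
      using pre_filter[OF i that V] by simp
    moreover have "compatible_opens (\<lambda>_. {})"
      unfolding compatible_opens_def pre_def by simp
    ultimately obtain W where W: "compatible_opens W" "\<forall>j\<in>I. W j \<notin> F j" "V \<subseteq> W i"
      using avoiding_extend[of "\<lambda>_. {}", OF _ i V] by auto
    then obtain x where "x \<in> topspace Lim" "\<forall>i\<in>I. x i \<notin> W i \<and> (\<forall>V\<in>F i. x i \<in> V)"
      using avoiding_point[of W] by auto
    then have "x \<in> kernel" "x \<notin> cyl i V"
      using W(3) i unfolding kernel_def cyl_def by auto
    then show False using sub by auto
  qed
qed (use i in \<open>auto simp: kernel_def cyl_def\<close>)

text \<open>Otherwise the directed unions of the sets \<open>under i U\<close>, for \<open>U \<in> D\<close>, avoid the filters, and the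
point of the kernel given by \<open>avoiding_point\<close> lies in no member of \<open>D\<close>.\<close>

lemma kernel_directed_cover:
  assumes D: "\<And>U. U \<in> D \<Longrightarrow> openin Lim U" "directed_set D (\<subseteq>)" "kernel \<subseteq> \<Union>D"
  shows "\<exists>U\<in>D. \<exists>i\<in>I. under i U \<in> F i"
proof (rule ccontr)
  assume neg: "\<not> ?thesis"
  define W where "W = (\<lambda>i. \<Union>(under i ` D))"
  have under_mono: "under i U \<subseteq> under i V" if "U \<subseteq> V" for i U V
    using that unfolding under_def by blast
  have "compatible_opens W"
    unfolding compatible_opens_def W_def
  proof (intro conjI ballI impI)
    fix i j assume ij: "i \<in> I" "j \<in> I" "le i j"
    have "pre i j (\<Union>(under i ` D)) = (\<Union>U\<in>D. pre i j (under i U))"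
      unfolding pre_def by auto
    then show "pre i j (\<Union>(under i ` D)) \<subseteq> \<Union>(under j ` D)"
      using pre_under[OF ij] by blast
  qed (use openin_under in auto)
  moreover have "W i \<notin> F i" if i: "i \<in> I" for i
  proof
    assume "W i \<in> F i"
    moreover have "directed_set (under i ` D) (\<subseteq>)"
      using D(2) under_mono by (intro directed_set_image_mono[of D "(\<subseteq>)"]) auto
    ultimately have "\<exists>V\<in>under i ` D. V \<in> F i"
      using openin_under unfolding W_def by (intro scott_open_filterD(5)[OF filter[OF i]]) auto
    then show False using neg i by auto
  qed
  ultimately obtain x where x: "x \<in> topspace Lim" "\<forall>i\<in>I. x i \<notin> W i \<and> (\<forall>V\<in>F i. x i \<in> V)"
    using avoiding_point[of W] by auto
  then have "x \<in> kernel" unfolding kernel_def by simp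
  then obtain U where U: "U \<in> D" "x \<in> U" using D(3) by auto
  then obtain i where "i \<in> I" "x \<in> cyl i (under i U)"
    using open_eq_Union_cyl_under[OF D(1)[OF U(1)]] by auto
  then show False using x(2) U(1) unfolding W_def cyl_def by auto
qed

lemma compactin_kernel: "compactin Lim kernel"
proof (rule compactin_directedI)
  show "kernel \<subseteq> topspace Lim" unfolding kernel_def by auto
  fix D assume D: "\<And>U. U \<in> D \<Longrightarrow> openin Lim U" "directed_set D (\<subseteq>)" "kernel \<subseteq> \<Union>D"
  then obtain U i where "U \<in> D" "i \<in> I" "under i U \<in> F i"
    using kernel_directed_cover[of D] by auto
  then have "kernel \<subseteq> U"
    using kernel_subset_cyl_iff[OF _ openin_under] cyl_under_subset by blast
  then show "\<exists>U\<in>D. kernel \<subseteq> U" using \<open>U \<in> D\<close> by auto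
qed

lemma saturatedin_kernel: "saturatedin Lim kernel"
  unfolding saturatedin_def
proof (intro conjI ballI allI impI)
  show "kernel \<subseteq> topspace Lim" unfolding kernel_def by auto
  fix x y assume x: "x \<in> kernel" and xy: "spec_le Lim x y"
  have "y i \<in> V" if "i \<in> I" "V \<in> F i" for i V
  proof -
    have "openin Lim (cyl i V)"
      using openin_cyl scott_open_filterD(1)[OF filter] that by auto
    moreover have "x \<in> cyl i V" using x that unfolding kernel_def cyl_def by auto
    ultimately show ?thesis using xy unfolding spec_le_def cyl_def by auto
  qed
  then show "y \<in> kernel" using xy unfolding kernel_def spec_le_def by auto
qed

lemma kernel_subset_iff:
  assumes "openin Lim U"
  shows "kernel \<subseteq> U \<longleftrightarrow> (\<exists>i\<in>I. under i U \<in> F i)"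
  using compactin_subset_iff_under[OF compactin_kernel assms] kernel_subset_cyl_iff[OF _ openin_under]
  by auto

text \<open>The set \<open>under i (U \<union> V)\<close> may be larger than \<open>under i U \<union> under i V\<close>. The cylinders over the latter
still form a directed cover of the kernel, and compactness picks one of them.\<close>

lemma kernel_subset_Un:
  assumes "openin Lim U" "openin Lim V" "kernel \<subseteq> U \<union> V"
  shows "\<exists>i\<in>I. under i U \<union> under i V \<in> F i"
proof -
  let ?f = "\<lambda>i. cyl i (under i U \<union> under i V)"
  have "U \<union> V \<subseteq> \<Union>(?f ` I)"
    using open_eq_Union_cyl_under[OF assms(1)] open_eq_Union_cyl_under[OF assms(2)]
    unfolding cyl_Un by blast
  then have cov: "kernel \<subseteq> \<Union>(?f ` I)" using assms(3) by auto
  have "directed_set (?f ` I) (\<subseteq>)"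
    using directed
  proof (rule directed_set_image_mono)
    fix i j assume "i \<in> I" "j \<in> I" "le i j"
    then show "?f i \<subseteq> ?f j"
      unfolding cyl_Un using cyl_under_mono by (intro Un_mono) auto
  qed
  then have "\<exists>W\<in>?f ` I. kernel \<subseteq> W"
    using cov by (intro compactin_directedD[OF compactin_kernel])
      (auto intro!: openin_cyl openin_Un openin_under)
  then show ?thesis
    using kernel_subset_cyl_iff[OF _ openin_Un[OF openin_under openin_under]] by auto
qed

text \<open>Each law for the limit is reduced to the same law at one index \<open>i\<close>, for the sets \<open>under i U\<close> and
\<open>under i V\<close>. In the third law the two premises may hold at different indices, which are moved to
a common upper bound.\<close>

lemma quasi_lens_kernel:
  assumes C: "closedin Lim C"
    and meets: "\<And>i V. i \<in> I \<Longrightarrow> openin (Xs i) V \<Longrightarrow> C \<inter> cyl i V \<noteq> {} \<longleftrightarrow> H i V"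
    and linked: "\<And>i. i \<in> I \<Longrightarrow> linked (Xs i) (\<lambda>V. V \<in> F i) (H i)"
  shows "quasi_lens Lim (kernel, C)"
proof -
  have "linked Lim (\<lambda>U. kernel \<subseteq> U) (\<lambda>U. C \<inter> U \<noteq> {})"
    unfolding linked_def
  proof (intro conjI allI impI; elim conjE)
    fix U assume U: "openin Lim U" "kernel \<subseteq> U"
    then obtain i where i: "i \<in> I" "under i U \<in> F i" using kernel_subset_iff by auto
    then have "H i (under i U)" using linkedD(1)[OF linked[OF i(1)] openin_under] by simp
    then show "C \<inter> U \<noteq> {}"
      using meets[OF i(1) openin_under, of U] cyl_under_subset[of i U] by auto
  next
    fix U V assume UV: "openin Lim U" "openin Lim V" "\<not> C \<inter> U \<noteq> {}" "kernel \<subseteq> U \<union> V"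
    then obtain i where i: "i \<in> I" "under i U \<union> under i V \<in> F i"
      using kernel_subset_Un[of U V] by blast
    have "\<not> H i (under i U)"
      using meets[OF i(1) openin_under, of U] cyl_under_subset[of i U] UV(3) by auto
    then have "under i V \<in> F i"
      using linkedD(2)[OF linked[OF i(1)] openin_under openin_under] i(2) by simp
    then show "kernel \<subseteq> V" using kernel_subset_iff[OF UV(2)] i(1) by auto
  next
    fix U V assume UV: "openin Lim U" "openin Lim V" "kernel \<subseteq> U" "C \<inter> V \<noteq> {}"
    obtain i where i: "i \<in> I" "under i U \<in> F i" using kernel_subset_iff[OF UV(1)] UV(3) by auto
    obtain j where j: "j \<in> I" "C \<inter> cyl j (under j V) \<noteq> {}" using meets_iff_under[OF UV(2)] UV(4) by auto
    obtain k where k: "k \<in> I" "le i k" "le j k" using upper_bound[OF i(1) j(1)] .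
    have "pre i k (under i U) \<in> F k"
      using pre_filter[OF i(1) k(1,2) openin_under] i(2) by simp
    then have "under k U \<in> F k"
      using filter_up[OF k(1) _ openin_under pre_under[OF i(1) k(1,2)]] by simp
    moreover have "H k (under k V)"
      using meets[OF k(1) openin_under] j(2) cyl_under_mono[OF j(1) k(1,3), of V] by blast
    ultimately have "H k (under k U \<inter> under k V)"
      using linkedD(3)[OF linked[OF k(1)] openin_under openin_under] by simp
    then have "C \<inter> (cyl k (under k U) \<inter> cyl k (under k V)) \<noteq> {}"
      using meets[OF k(1) openin_Int[OF openin_under openin_under]] by (simp add: cyl_Int)
    then show "C \<inter> (U \<inter> V) \<noteq> {}"
      using cyl_under_subset[of k U] cyl_under_subset[of k V] by blast
  qed
  then show ?thesis
    unfolding quasi_lens_iff_linked using compactin_kernel saturatedin_kernel C by simp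
qed

end

section \<open>The limit theorem\<close>

context proj_system
begin

text \<open>The tests on open sets say that the \<open>C i\<close> form a point of the limit of the hyperspaces, which has
a preimage under the comparison map.\<close>

lemma closed_set_of_compatible_family:
  assumes HV: "is_projective_limit I le (\<lambda>i. HV (Xs i)) (\<lambda>i j. HV_map (Xs i) (p i j))
           (HV Lim) (\<lambda>i. HV_map (Xs i) (\<lambda>x. x i))"
    and C: "\<And>i. i \<in> I \<Longrightarrow> closedin (Xs i) (C i)" "\<And>i. i \<in> I \<Longrightarrow> C i \<noteq> {}"
    and compat: "\<And>i j V. i \<in> I \<Longrightarrow> j \<in> I \<Longrightarrow> le i j \<Longrightarrow> openin (Xs i) V \<Longrightarrow>
        C j \<inter> pre i j V \<noteq> {} \<longleftrightarrow> C i \<inter> V \<noteq> {}"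
  shows "\<exists>K. closedin Lim K \<and>
    (\<forall>i\<in>I. \<forall>V. openin (Xs i) V \<longrightarrow> (K \<inter> cyl i V \<noteq> {} \<longleftrightarrow> C i \<inter> V \<noteq> {}))"
proof -
  let ?L = "canonical_limit I le (\<lambda>i. HV (Xs i)) (\<lambda>i j. HV_map (Xs i) (p i j))"
  let ?h = "\<lambda>K. \<lambda>i\<in>I. HV_map (Xs i) (\<lambda>x. x i) K"
  have sub: "C i \<subseteq> topspace (Xs i)" if "i \<in> I" for i
    using closedin_subset[OF C(1)[OF that]] .
  have "HV_map (Xs i) (p i j) (C j) = C i" if ij: "i \<in> I" "j \<in> I" "le i j" for i j
  proof (rule closedin_eqI)
    show "closedin (Xs i) (HV_map (Xs i) (p i j) (C j))" by (simp add: HV_map_def)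
    show "closedin (Xs i) (C i)" using C(1) ij by simp
    fix V assume V: "openin (Xs i) V"
    have "p i j ` C j \<subseteq> topspace (Xs i)" using sub[OF ij(2)] bond_in[OF ij] by auto
    then have "HV_map (Xs i) (p i j) (C j) \<inter> V \<noteq> {} \<longleftrightarrow> p i j ` C j \<inter> V \<noteq> {}"
      unfolding HV_map_def using V by (rule closure_of_meets_open_iff)
    also have "\<dots> \<longleftrightarrow> C j \<inter> pre i j V \<noteq> {}"
      using sub[OF ij(2)] unfolding pre_def by auto
    finally show "HV_map (Xs i) (p i j) (C j) \<inter> V \<noteq> {} \<longleftrightarrow> C i \<inter> V \<noteq> {}"
      using compat[OF ij V] by simp
  qed
  then have "restrict C I \<in> topspace ?L"
    unfolding canonical_limit_def using C by (auto simp: topspace_HV)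
  moreover have "?h ` topspace (HV Lim) = topspace ?L"
    using HV homeomorphic_imp_surjective_map unfolding is_projective_limit_def by blast
  ultimately have "restrict C I \<in> ?h ` topspace (HV Lim)" by simp
  then obtain K where K: "K \<in> topspace (HV Lim)" "restrict C I = ?h K"
    by (rule imageE) simp
  have Kc: "closedin Lim K" using K(1) by (simp add: topspace_HV)
  have "K \<inter> cyl i V \<noteq> {} \<longleftrightarrow> C i \<inter> V \<noteq> {}" if i: "i \<in> I" and V: "openin (Xs i) V" for i V
  proof -
    have "C i = Xs i closure_of ((\<lambda>x. x i) ` K)"
      using fun_cong[OF K(2), of i] i by (simp add: HV_map_def)
    moreover have "(\<lambda>x. x i) ` K \<subseteq> topspace (Xs i)"
      using closedin_subset[OF Kc] Lim_coord i by auto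
    ultimately have "C i \<inter> V \<noteq> {} \<longleftrightarrow> (\<lambda>x. x i) ` K \<inter> V \<noteq> {}"
      using V closure_of_meets_open_iff by simp
    then show ?thesis using closedin_subset[OF Kc] unfolding cyl_def by auto
  qed
  then show ?thesis using Kc by (intro exI[of _ K]) simp
qed

text \<open>Surjectivity of both comparison maps at once: the tests may come from quasi-lenses or from
valuations on the factors.\<close>

lemma quasi_lens_of_compatible_family:
  assumes HV: "is_projective_limit I le (\<lambda>i. HV (Xs i)) (\<lambda>i j. HV_map (Xs i) (p i j))
           (HV Lim) (\<lambda>i. HV_map (Xs i) (\<lambda>x. x i))"
    and sober: "\<And>i. i \<in> I \<Longrightarrow> sober_space (Xs i)"
    and N: "\<And>i. i \<in> I \<Longrightarrow> scott_open_filter (Xs i) {V. openin (Xs i) V \<and> N i V}"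
    and H: "\<And>i. i \<in> I \<Longrightarrow> \<exists>C. closedin (Xs i) C \<and> (\<forall>V. openin (Xs i) V \<longrightarrow> (H i V \<longleftrightarrow> C \<inter> V \<noteq> {}))"
    and linked: "\<And>i. i \<in> I \<Longrightarrow> linked (Xs i) (N i) (H i)"
    and N_pre: "\<And>i j V. i \<in> I \<Longrightarrow> j \<in> I \<Longrightarrow> le i j \<Longrightarrow> openin (Xs i) V \<Longrightarrow> N j (pre i j V) \<longleftrightarrow> N i V"
    and H_pre: "\<And>i j V. i \<in> I \<Longrightarrow> j \<in> I \<Longrightarrow> le i j \<Longrightarrow> openin (Xs i) V \<Longrightarrow> H j (pre i j V) \<longleftrightarrow> H i V"
  shows "\<exists>Q K. quasi_lens Lim (Q, K) \<and> (\<forall>i\<in>I. \<forall>V. openin (Xs i) V \<longrightarrow>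
    (Q \<subseteq> cyl i V \<longleftrightarrow> N i V) \<and> (K \<inter> cyl i V \<noteq> {} \<longleftrightarrow> H i V))"
proof -
  interpret filtered_proj_system I le Xs p "\<lambda>i. {V. openin (Xs i) V \<and> N i V}"
    using sober N N_pre openin_pre by unfold_locales auto
  obtain C where C: "\<And>i. i \<in> I \<Longrightarrow> closedin (Xs i) (C i)"
    "\<And>i V. i \<in> I \<Longrightarrow> openin (Xs i) V \<Longrightarrow> H i V \<longleftrightarrow> C i \<inter> V \<noteq> {}"
    using H by metis
  have "C i \<noteq> {}" if i: "i \<in> I" for i
  proof -
    have "H i (topspace (Xs i))"
      using linkedD(1)[OF linked[OF i]] scott_open_filterD(2)[OF N[OF i]] by simp
    then show ?thesis using C(2)[OF i] by auto
  qed
  then obtain K where K: "closedin Lim K"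
    "\<And>i V. i \<in> I \<Longrightarrow> openin (Xs i) V \<Longrightarrow> K \<inter> cyl i V \<noteq> {} \<longleftrightarrow> H i V"
    using closed_set_of_compatible_family[OF HV, of C] C H_pre openin_pre by auto
  have "linked (Xs i) (\<lambda>V. V \<in> {V. openin (Xs i) V \<and> N i V}) (H i)" if "i \<in> I" for i
    using linked[OF that] by (simp cong: linked_cong)
  then have "quasi_lens Lim (kernel, K)"
    using quasi_lens_kernel[OF K] by simp
  moreover have "kernel \<subseteq> cyl i V \<longleftrightarrow> N i V" if "i \<in> I" "openin (Xs i) V" for i V
    using kernel_subset_cyl_iff[OF that] that by simp
  ultimately show ?thesis using K(2) by (intro exI[of _ kernel] exI[of _ K]) simp
qed

lemma PqV_bond_tests:
  assumes ij: "i \<in> I" "j \<in> I" "le i j" and L: "quasi_lens (Xs j) L" and V: "openin (Xs i) V"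
  shows "fst L \<subseteq> pre i j V \<longleftrightarrow> fst (PqV_map (Xs i) (p i j) L) \<subseteq> V"
    and "snd L \<inter> pre i j V \<noteq> {} \<longleftrightarrow> snd (PqV_map (Xs i) (p i j) L) \<inter> V \<noteq> {}"
  using PqV_map_tests[OF continuous_bond[OF ij] L V] by (simp_all add: pre_def)

lemma PqV_proj_tests:
  assumes "i \<in> I" "quasi_lens Lim L" "openin (Xs i) V"
  shows "fst L \<subseteq> cyl i V \<longleftrightarrow> fst (PqV_map (Xs i) (\<lambda>x. x i) L) \<subseteq> V"
    and "snd L \<inter> cyl i V \<noteq> {} \<longleftrightarrow> snd (PqV_map (Xs i) (\<lambda>x. x i) L) \<inter> V \<noteq> {}"
  using PqV_map_tests[OF continuous_proj[OF assms(1)] assms(2,3)] by (simp_all add: cyl_def)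

text \<open>Compactness of the first component is what makes the directed union of cylinders suffice for the
first test.\<close>

lemma quasi_lens_tests_under:
  assumes L: "quasi_lens Lim L" and U: "openin Lim U"
  shows "fst L \<subseteq> U \<longleftrightarrow> (\<exists>i\<in>I. fst (PqV_map (Xs i) (\<lambda>x. x i) L) \<subseteq> under i U)"
    and "snd L \<inter> U \<noteq> {} \<longleftrightarrow> (\<exists>i\<in>I. snd (PqV_map (Xs i) (\<lambda>x. x i) L) \<inter> under i U \<noteq> {})"
proof -
  have "compactin Lim (fst L)"
    using L by (cases L) (simp add: quasi_lens_iff_linked)
  from compactin_subset_iff_under[OF this U] meets_iff_under[OF U]
  show "fst L \<subseteq> U \<longleftrightarrow> (\<exists>i\<in>I. fst (PqV_map (Xs i) (\<lambda>x. x i) L) \<subseteq> under i U)"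
    "snd L \<inter> U \<noteq> {} \<longleftrightarrow> (\<exists>i\<in>I. snd (PqV_map (Xs i) (\<lambda>x. x i) L) \<inter> under i U \<noteq> {})"
    using PqV_proj_tests[OF _ L openin_under] by auto
qed

lemma PAV_proj_apply:
  "openin (Xs i) V \<Longrightarrow> PAV_map Lim (Xs i) (\<lambda>x. x i) \<alpha> V = \<alpha> (cyl i V)"
  by (simp add: PAV_map_apply cyl_def)

lemma PqV_limit:
  assumes HV: "is_projective_limit I le (\<lambda>i. HV (Xs i)) (\<lambda>i j. HV_map (Xs i) (p i j))
           (HV Lim) (\<lambda>i. HV_map (Xs i) (\<lambda>x. x i))"
    and sober: "\<And>i. i \<in> I \<Longrightarrow> sober_space (Xs i)"
  shows "is_projective_limit I le (\<lambda>i. PqV (Xs i)) (\<lambda>i j. PqV_map (Xs i) (p i j))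
           (PqV Lim) (\<lambda>i. PqV_map (Xs i) (\<lambda>x. x i))"
proof (rule is_projective_limitI[OF PqV_eq_subbase])
  show "continuous_map (PqV Lim) (PqV (Xs i)) (PqV_map (Xs i) (\<lambda>x. x i))" if "i \<in> I" for i
    using continuous_proj[OF that] by (rule continuous_map_PqV_map)
  show "PqV_map (Xs i) (p i j) (PqV_map (Xs j) (\<lambda>x. x j) L) = PqV_map (Xs i) (\<lambda>x. x i) L"
    if "i \<in> I" "j \<in> I" "le i j" "L \<in> topspace (PqV Lim)" for i j L
    using that Lim_bond by (intro PqV_map_comp[OF continuous_proj continuous_bond continuous_proj])
      (auto simp: topspace_PqV)
  show "L = L'" if L: "L \<in> topspace (PqV Lim)" "L' \<in> topspace (PqV Lim)"
    and eq: "\<And>i. i \<in> I \<Longrightarrow> PqV_map (Xs i) (\<lambda>x. x i) L = PqV_map (Xs i) (\<lambda>x. x i) L'" for L L'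
  proof (rule quasi_lens_eqI)
    show q: "quasi_lens Lim L" "quasi_lens Lim L'" using L by (simp_all add: topspace_PqV)
    fix U assume U: "openin Lim U"
    show "fst L \<subseteq> U \<longleftrightarrow> fst L' \<subseteq> U" "snd L \<inter> U \<noteq> {} \<longleftrightarrow> snd L' \<inter> U \<noteq> {}"
      unfolding quasi_lens_tests_under[OF q(1) U] quasi_lens_tests_under[OF q(2) U]
      using eq by auto
  qed
  show "\<exists>L\<in>topspace (PqV Lim). \<forall>i\<in>I. PqV_map (Xs i) (\<lambda>x. x i) L = z i"
    if z_top: "\<And>i. i \<in> I \<Longrightarrow> z i \<in> topspace (PqV (Xs i))"
      and z_bond: "\<And>i j. i \<in> I \<Longrightarrow> j \<in> I \<Longrightarrow> le i j \<Longrightarrow> PqV_map (Xs i) (p i j) (z j) = z i" for z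
  proof -
    have q: "quasi_lens (Xs i) (z i)" if "i \<in> I" for i
      using z_top[OF that] by (simp add: topspace_PqV)
    then have q': "compactin (Xs i) (fst (z i))" "closedin (Xs i) (snd (z i))"
      "linked (Xs i) (\<lambda>U. fst (z i) \<subseteq> U) (\<lambda>U. snd (z i) \<inter> U \<noteq> {})" if "i \<in> I" for i
      using that quasi_lens_iff_linked[of "Xs i" "fst (z i)" "snd (z i)"] by simp_all
    have "\<exists>Q K. quasi_lens Lim (Q, K) \<and> (\<forall>i\<in>I. \<forall>V. openin (Xs i) V \<longrightarrow>
      (Q \<subseteq> cyl i V \<longleftrightarrow> fst (z i) \<subseteq> V) \<and> (K \<inter> cyl i V \<noteq> {} \<longleftrightarrow> snd (z i) \<inter> V \<noteq> {}))"
    proof (rule quasi_lens_of_compatible_family[OF HV sober])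
      show "scott_open_filter (Xs i) {V. openin (Xs i) V \<and> fst (z i) \<subseteq> V}" if "i \<in> I" for i
        using q'(1)[OF that] by (rule scott_open_filter_neighbourhoods)
      show "\<exists>C. closedin (Xs i) C \<and> (\<forall>V. openin (Xs i) V \<longrightarrow> (snd (z i) \<inter> V \<noteq> {} \<longleftrightarrow> C \<inter> V \<noteq> {}))"
        if "i \<in> I" for i
        using q'(2)[OF that] by auto
      show "fst (z j) \<subseteq> pre i j V \<longleftrightarrow> fst (z i) \<subseteq> V"
        "snd (z j) \<inter> pre i j V \<noteq> {} \<longleftrightarrow> snd (z i) \<inter> V \<noteq> {}"
        if "i \<in> I" "j \<in> I" "le i j" "openin (Xs i) V" for i j V
        using PqV_bond_tests[OF that(1-3) q[OF that(2)] that(4)] z_bond[OF that(1-3)]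
        by simp_all
    qed (use q'(3) in auto)
    then obtain Q K where L: "quasi_lens Lim (Q, K)"
      and tests: "\<And>i V. i \<in> I \<Longrightarrow> openin (Xs i) V \<Longrightarrow> Q \<subseteq> cyl i V \<longleftrightarrow> fst (z i) \<subseteq> V"
        "\<And>i V. i \<in> I \<Longrightarrow> openin (Xs i) V \<Longrightarrow> K \<inter> cyl i V \<noteq> {} \<longleftrightarrow> snd (z i) \<inter> V \<noteq> {}"
      by auto
    have "PqV_map (Xs i) (\<lambda>x. x i) (Q, K) = z i" if i: "i \<in> I" for i
    proof (rule quasi_lens_eqI[OF quasi_lens_PqV_map[OF continuous_proj[OF i] L] q[OF i]])
      fix V assume V: "openin (Xs i) V"
      show "fst (PqV_map (Xs i) (\<lambda>x. x i) (Q, K)) \<subseteq> V \<longleftrightarrow> fst (z i) \<subseteq> V"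
        "snd (PqV_map (Xs i) (\<lambda>x. x i) (Q, K)) \<inter> V \<noteq> {} \<longleftrightarrow> snd (z i) \<inter> V \<noteq> {}"
        using PqV_proj_tests[OF i L V] tests(1)[OF i V] tests(2)[OF i V] by simp_all
    qed
    then show ?thesis using L by (intro bexI[of _ "(Q, K)"]) (simp_all add: topspace_PqV)
  qed
  show "\<exists>i\<in>I. \<exists>W. openin (PqV (Xs i)) W \<and> PqV_map (Xs i) (\<lambda>x. x i) L \<in> W \<and>
      (\<forall>L'\<in>topspace (PqV Lim). PqV_map (Xs i) (\<lambda>x. x i) L' \<in> W \<longrightarrow> L' \<in> B)"
    if sub: "B \<in> PqV_subbase Lim" and mem: "L \<in> B" for B L
  proof -
    obtain U where U: "openin Lim U"
      and B: "B = {L. quasi_lens Lim L \<and> fst L \<subseteq> U} \<or> B = {L. quasi_lens Lim L \<and> snd L \<inter> U \<noteq> {}}"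
      using sub unfolding PqV_subbase_def by blast
    have L: "quasi_lens Lim L" using mem B by auto
    have lens: "quasi_lens (Xs i) (PqV_map (Xs i) (\<lambda>x. x i) L)" if "i \<in> I" for i
      using quasi_lens_PqV_map[OF continuous_proj[OF that] L] .
    from B show ?thesis
    proof
      assume B: "B = {L. quasi_lens Lim L \<and> fst L \<subseteq> U}"
      then obtain i where i: "i \<in> I" "fst (PqV_map (Xs i) (\<lambda>x. x i) L) \<subseteq> under i U"
        using quasi_lens_tests_under(1)[OF L U] mem by auto
      show ?thesis
      proof (intro bexI[OF _ i(1)] exI conjI ballI impI)
        show "openin (PqV (Xs i)) {K. quasi_lens (Xs i) K \<and> fst K \<subseteq> under i U}"
          by (rule openin_PqV[OF openin_under])
        show "PqV_map (Xs i) (\<lambda>x. x i) L \<in> {K. quasi_lens (Xs i) K \<and> fst K \<subseteq> under i U}"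
          using lens i by simp
        fix L' assume "L' \<in> topspace (PqV Lim)"
          "PqV_map (Xs i) (\<lambda>x. x i) L' \<in> {K. quasi_lens (Xs i) K \<and> fst K \<subseteq> under i U}"
        then show "L' \<in> B"
          using quasi_lens_tests_under(1)[of L', OF _ U] i(1) unfolding B topspace_PqV by auto
      qed
    next
      assume B: "B = {L. quasi_lens Lim L \<and> snd L \<inter> U \<noteq> {}}"
      then obtain i where i: "i \<in> I" "snd (PqV_map (Xs i) (\<lambda>x. x i) L) \<inter> under i U \<noteq> {}"
        using quasi_lens_tests_under(2)[OF L U] mem by auto
      show ?thesis
      proof (intro bexI[OF _ i(1)] exI conjI ballI impI)
        show "openin (PqV (Xs i)) {K. quasi_lens (Xs i) K \<and> snd K \<inter> under i U \<noteq> {}}"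
          by (rule openin_PqV[OF openin_under])
        show "PqV_map (Xs i) (\<lambda>x. x i) L \<in> {K. quasi_lens (Xs i) K \<and> snd K \<inter> under i U \<noteq> {}}"
          using lens i by simp
        fix L' assume "L' \<in> topspace (PqV Lim)"
          "PqV_map (Xs i) (\<lambda>x. x i) L' \<in> {K. quasi_lens (Xs i) K \<and> snd K \<inter> under i U \<noteq> {}}"
        then show "L' \<in> B"
          using quasi_lens_tests_under(2)[of L', OF _ U] i(1) unfolding B topspace_PqV by auto
      qed
    qed
  qed
qed

lemma PAV_limit:
  assumes HV: "is_projective_limit I le (\<lambda>i. HV (Xs i)) (\<lambda>i j. HV_map (Xs i) (p i j))
           (HV Lim) (\<lambda>i. HV_map (Xs i) (\<lambda>x. x i))"
    and sober: "\<And>i. i \<in> I \<Longrightarrow> sober_space (Xs i)"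
  shows "is_projective_limit I le (\<lambda>i. PAV (Xs i)) (\<lambda>i j. PAV_map (Xs j) (Xs i) (p i j))
           (PAV Lim) (\<lambda>i. PAV_map Lim (Xs i) (\<lambda>x. x i))"
proof (rule is_projective_limitI[OF PAV_eq_subbase])
  show "continuous_map (PAV Lim) (PAV (Xs i)) (PAV_map Lim (Xs i) (\<lambda>x. x i))" if "i \<in> I" for i
    using continuous_proj[OF that] by (rule continuous_map_PAV_map)
  show "PAV_map (Xs j) (Xs i) (p i j) (PAV_map Lim (Xs j) (\<lambda>x. x j) \<alpha>) = PAV_map Lim (Xs i) (\<lambda>x. x i) \<alpha>"
    if "i \<in> I" "j \<in> I" "le i j" for i j \<alpha>
    using that Lim_bond by (intro PAV_map_comp[OF continuous_proj continuous_bond]) auto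
  have tests: "\<alpha> U = A1 \<longleftrightarrow> (\<exists>i\<in>I. PAV_map Lim (Xs i) (\<lambda>x. x i) \<alpha> (under i U) = A1)"
    "\<alpha> U \<noteq> A0 \<longleftrightarrow> (\<exists>i\<in>I. PAV_map Lim (Xs i) (\<lambda>x. x i) \<alpha> (under i U) \<noteq> A0)"
    if "A_valuation Lim \<alpha>" "openin Lim U" for \<alpha> U
    using A_valuation_iff_under[OF that] by (simp_all add: PAV_proj_apply[OF openin_under])
  show "\<alpha> = \<beta>" if "\<alpha> \<in> topspace (PAV Lim)" "\<beta> \<in> topspace (PAV Lim)"
    and eq: "\<And>i. i \<in> I \<Longrightarrow> PAV_map Lim (Xs i) (\<lambda>x. x i) \<alpha> = PAV_map Lim (Xs i) (\<lambda>x. x i) \<beta>" for \<alpha> \<beta>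
  proof -
    have v: "A_valuation Lim \<alpha>" "A_valuation Lim \<beta>" using that by (simp_all add: topspace_PAV)
    show ?thesis
    proof (rule extensionalityI)
      show "\<alpha> \<in> extensional {U. openin Lim U}" "\<beta> \<in> extensional {U. openin Lim U}"
        using v by (simp_all add: A_valuation_def)
      fix U assume "U \<in> {U. openin Lim U}"
      then have U: "openin Lim U" by simp
      show "\<alpha> U = \<beta> U"
        by (rule three_eqI; unfold tests[OF v(1) U] tests[OF v(2) U]) (simp_all add: eq)
    qed
  qed
  show "\<exists>\<alpha>\<in>topspace (PAV Lim). \<forall>i\<in>I. PAV_map Lim (Xs i) (\<lambda>x. x i) \<alpha> = z i"
    if z_top: "\<And>i. i \<in> I \<Longrightarrow> z i \<in> topspace (PAV (Xs i))"
      and z_bond: "\<And>i j. i \<in> I \<Longrightarrow> j \<in> I \<Longrightarrow> le i j \<Longrightarrow> PAV_map (Xs j) (Xs i) (p i j) (z j) = z i" for z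
  proof -
    have v: "A_valuation (Xs i) (z i)" if "i \<in> I" for i
      using z_top[OF that] by (simp add: topspace_PAV)
    have bond: "z j (pre i j V) = z i V" if "i \<in> I" "j \<in> I" "le i j" "openin (Xs i) V" for i j V
      using z_bond[OF that(1-3)] PAV_map_apply[OF that(4), of "Xs j" "p i j" "z j"]
      by (simp add: pre_def)
    have "\<exists>Q K. quasi_lens Lim (Q, K) \<and> (\<forall>i\<in>I. \<forall>V. openin (Xs i) V \<longrightarrow>
      (Q \<subseteq> cyl i V \<longleftrightarrow> z i V = A1) \<and> (K \<inter> cyl i V \<noteq> {} \<longleftrightarrow> z i V \<noteq> A0))"
      using v bond unfolding A_valuation_iff_linked
      by (intro quasi_lens_of_compatible_family[OF HV sober]) simp_all
    then obtain Q K where L: "quasi_lens Lim (Q, K)"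
      and QK: "\<And>i V. i \<in> I \<Longrightarrow> openin (Xs i) V \<Longrightarrow> Q \<subseteq> cyl i V \<longleftrightarrow> z i V = A1"
        "\<And>i V. i \<in> I \<Longrightarrow> openin (Xs i) V \<Longrightarrow> K \<inter> cyl i V \<noteq> {} \<longleftrightarrow> z i V \<noteq> A0"
      by auto
    obtain \<alpha> where \<alpha>: "A_valuation Lim \<alpha>"
      "\<And>U. openin Lim U \<Longrightarrow> \<alpha> U = A1 \<longleftrightarrow> Q \<subseteq> U"
      "\<And>U. openin Lim U \<Longrightarrow> \<alpha> U \<noteq> A0 \<longleftrightarrow> K \<inter> U \<noteq> {}"
      using A_valuation_of_quasi_lens[OF L] by auto
    have "PAV_map Lim (Xs i) (\<lambda>x. x i) \<alpha> = z i" if i: "i \<in> I" for i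
    proof (rule extensionalityI)
      show "PAV_map Lim (Xs i) (\<lambda>x. x i) \<alpha> \<in> extensional {U. openin (Xs i) U}"
        by (simp add: PAV_map_def)
      show "z i \<in> extensional {U. openin (Xs i) U}"
        using v[OF i] by (simp add: A_valuation_def)
      fix V assume "V \<in> {U. openin (Xs i) U}"
      then have V: "openin (Xs i) V" by simp
      show "PAV_map Lim (Xs i) (\<lambda>x. x i) \<alpha> V = z i V"
        unfolding PAV_proj_apply[OF V]
        using \<alpha>(2,3)[OF openin_cyl[OF i V]] QK[OF i V] by (intro three_eqI) simp_all
    qed
    then show ?thesis using \<alpha>(1) by (intro bexI[of _ \<alpha>]) (simp_all add: topspace_PAV)
  qed
  show "\<exists>i\<in>I. \<exists>W. openin (PAV (Xs i)) W \<and> PAV_map Lim (Xs i) (\<lambda>x. x i) \<alpha> \<in> W \<and>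
      (\<forall>\<beta>\<in>topspace (PAV Lim). PAV_map Lim (Xs i) (\<lambda>x. x i) \<beta> \<in> W \<longrightarrow> \<beta> \<in> B)"
    if sub: "B \<in> PAV_subbase Lim" and mem: "\<alpha> \<in> B" for B \<alpha>
  proof -
    obtain U where U: "openin Lim U"
      and B: "B = {\<alpha>. A_valuation Lim \<alpha> \<and> \<alpha> U = A1} \<or> B = {\<alpha>. A_valuation Lim \<alpha> \<and> \<alpha> U \<noteq> A0}"
      using sub unfolding PAV_subbase_def by blast
    have \<alpha>: "A_valuation Lim \<alpha>" using mem B by auto
    have val: "A_valuation (Xs i) (PAV_map Lim (Xs i) (\<lambda>x. x i) \<alpha>)" if "i \<in> I" for i
      using A_valuation_PAV_map[OF continuous_proj[OF that] \<alpha>] .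
    from B show ?thesis
    proof
      assume B: "B = {\<alpha>. A_valuation Lim \<alpha> \<and> \<alpha> U = A1}"
      then obtain i where i: "i \<in> I" "PAV_map Lim (Xs i) (\<lambda>x. x i) \<alpha> (under i U) = A1"
        using tests(1)[OF \<alpha> U] mem by auto
      show ?thesis
      proof (intro bexI[OF _ i(1)] exI conjI ballI impI)
        show "openin (PAV (Xs i)) {\<beta>. A_valuation (Xs i) \<beta> \<and> \<beta> (under i U) = A1}"
          by (rule openin_PAV[OF openin_under])
        show "PAV_map Lim (Xs i) (\<lambda>x. x i) \<alpha> \<in> {\<beta>. A_valuation (Xs i) \<beta> \<and> \<beta> (under i U) = A1}"
          using val i by simp
        fix \<beta> assume "\<beta> \<in> topspace (PAV Lim)"
          "PAV_map Lim (Xs i) (\<lambda>x. x i) \<beta> \<in> {\<beta>. A_valuation (Xs i) \<beta> \<and> \<beta> (under i U) = A1}"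
        then show "\<beta> \<in> B"
          using tests(1)[of \<beta>, OF _ U] i(1) unfolding B topspace_PAV by auto
      qed
    next
      assume B: "B = {\<alpha>. A_valuation Lim \<alpha> \<and> \<alpha> U \<noteq> A0}"
      then obtain i where i: "i \<in> I" "PAV_map Lim (Xs i) (\<lambda>x. x i) \<alpha> (under i U) \<noteq> A0"
        using tests(2)[OF \<alpha> U] mem by auto
      show ?thesis
      proof (intro bexI[OF _ i(1)] exI conjI ballI impI)
        show "openin (PAV (Xs i)) {\<beta>. A_valuation (Xs i) \<beta> \<and> \<beta> (under i U) \<noteq> A0}"
          by (rule openin_PAV[OF openin_under])
        show "PAV_map Lim (Xs i) (\<lambda>x. x i) \<alpha> \<in> {\<beta>. A_valuation (Xs i) \<beta> \<and> \<beta> (under i U) \<noteq> A0}"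
          using val i by simp
        fix \<beta> assume "\<beta> \<in> topspace (PAV Lim)"
          "PAV_map Lim (Xs i) (\<lambda>x. x i) \<beta> \<in> {\<beta>. A_valuation (Xs i) \<beta> \<and> \<beta> (under i U) \<noteq> A0}"
        then show "\<beta> \<in> B"
          using tests(2)[of \<beta>, OF _ U] i(1) unfolding B topspace_PAV by auto
      qed
    qed
  qed
qed

end

theorem theorem8p8:
  fixes I :: "'i set" and le :: "'i \<Rightarrow> 'i \<Rightarrow> bool"
    and Xs :: "'i \<Rightarrow> 'a topology" and p :: "'i \<Rightarrow> 'i \<Rightarrow> 'a \<Rightarrow> 'a"
    and X :: "('i \<Rightarrow> 'a) topology"
  assumes "projective_system I le Xs p"
    and "X = canonical_limit I le Xs p"
    and "\<And>i. i \<in> I \<Longrightarrow> sober_space (Xs i)"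
    and "is_projective_limit I le (\<lambda>i. HV (Xs i)) (\<lambda>i j. HV_map (Xs i) (p i j))
           (HV X) (\<lambda>i. HV_map (Xs i) (\<lambda>x. x i))"
  shows "is_projective_limit I le (\<lambda>i. PqV (Xs i)) (\<lambda>i j. PqV_map (Xs i) (p i j))
           (PqV X) (\<lambda>i. PqV_map (Xs i) (\<lambda>x. x i))
       \<and> is_projective_limit I le (\<lambda>i. PAV (Xs i)) (\<lambda>i j. PAV_map (Xs j) (Xs i) (p i j))
           (PAV X) (\<lambda>i. PAV_map X (Xs i) (\<lambda>x. x i))"
proof -
  interpret proj_system I le Xs p
    using assms(1) by (rule proj_system.intro)
  have X: "X = Lim" using assms(2) by (simp add: Lim_def)
  show ?thesis
    using PqV_limit PAV_limit assms(3,4) unfolding X by auto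
qed

end
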